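(* Let $r\ge 2$, $k\ge 4$, and let $G$ be either the free metabelian group $M_r$ of rank $r$ or the free metabelian nilpotent group $M_{rk}$ of rank $r$ and nilpotency class $k$. Let $H=\langle g,f\rangle$ be a two-generated subgroup of $G$. Then the following are equivalent: (1) $H$ is a retract of $G$; (2) $H$ is algebraically closed in $G$; (3) $H$ is verbally closed in $G$.
   Context: $M_r$ is the free group of rank $r$ in the variety of metabelian groups; $M_{rk}$ is the free group of rank $r$ in the variety of metabelian groups that are nilpotent of class at most $k$. A subgroup $H$ of $G$ is a retract if there is a homomorphism $G\to H$ restricting to the identity on $H$. $H$ is algebraically closed in $G$ if every finite system of equations $E_i(x_1,\dots,x_n,H)=1$ ($i=1,\dots,m$) with constants from $H$ that has a solution in $G$ also has a solution in $H$. Let $F(X)$ be the free group on a countably infinite set $X=\{x_1,x_2,\dots\}$; $H$ is verbally closed in $G$ if for every $w=w(x_1,\dots,x_n)\in F(X)$ and every $h\in H$, the equation $w(x_1,\dots,x_n)=h$ has a solution in $G$ if and only if it has a solution in $H$. *)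

theory Defs
  imports "HOL-Algebra.Algebra"
begin

definition metabelian :: "'g monoid \<Rightarrow> bool" where
  "metabelian G \<longleftrightarrow> group G \<and> derived G (derived G (carrier G)) = {\<one>\<^bsub>G\<^esub>}"

fun lower_central :: "'g monoid \<Rightarrow> nat \<Rightarrow> 'g set" where
  "lower_central G 0 = carrier G"
| "lower_central G (Suc n) = generate G
     {a \<otimes>\<^bsub>G\<^esub> b \<otimes>\<^bsub>G\<^esub> inv\<^bsub>G\<^esub> a \<otimes>\<^bsub>G\<^esub> inv\<^bsub>G\<^esub> b | a b. a \<in> lower_central G n \<and> b \<in> carrier G}"

text \<open>Nilpotent of class at most k: gamma_(k+1)(G) = 1 (index shifted: lower_central G k = gamma_(k+1)).\<close>
definition nilpotent_class_le :: "'g monoid \<Rightarrow> nat \<Rightarrow> bool" where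
  "nilpotent_class_le G k \<longleftrightarrow> group G \<and> lower_central G k = {\<one>\<^bsub>G\<^esub>}"

definition metabelian_nilpotent :: "nat \<Rightarrow> 'g monoid \<Rightarrow> bool" where
  "metabelian_nilpotent k G \<longleftrightarrow> metabelian G \<and> nilpotent_class_le G k"

text \<open>G is free of rank r in the variety given by predicate V, with basis a 0, ..., a (r-1):
  G lies in V, is generated by the basis, and every map of the basis into a group of V
  (with carrier in the same, infinite, type) extends to a homomorphism.\<close>
definition relatively_free :: "('g monoid \<Rightarrow> bool) \<Rightarrow> 'g monoid \<Rightarrow> (nat \<Rightarrow> 'g) \<Rightarrow> nat \<Rightarrow> bool" where
  "relatively_free V G a r \<longleftrightarrow>
     group G \<and> V G \<and> inj_on a {..<r} \<and> a ` {..<r} \<subseteq> carrier G \<and>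
     generate G (a ` {..<r}) = carrier G \<and>
     (\<forall>K :: 'g monoid. \<forall>b. group K \<and> V K \<and> b ` {..<r} \<subseteq> carrier K \<longrightarrow>
        (\<exists>h \<in> hom G K. \<forall>i<r. h (a i) = b i))"

definition retract :: "'g set \<Rightarrow> 'g monoid \<Rightarrow> bool" where
  "retract H G \<longleftrightarrow> subgroup H G \<and>
     (\<exists>\<phi> \<in> hom G (G\<lparr>carrier := H\<rparr>). \<forall>x\<in>H. \<phi> x = x)"

text \<open>Group words in variables x_0, x_1, ... with constants of type 'c
  (elements of the free product F(X) * H).\<close>
datatype 'c gword = GVar nat | GConst 'c | GOne | GMul "'c gword" "'c gword" | GInv "'c gword"

primrec gconsts :: "'c gword \<Rightarrow> 'c set" where
  "gconsts (GVar i) = {}"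
| "gconsts (GConst c) = {c}"
| "gconsts GOne = {}"
| "gconsts (GMul u v) = gconsts u \<union> gconsts v"
| "gconsts (GInv u) = gconsts u"

primrec geval :: "'g monoid \<Rightarrow> (nat \<Rightarrow> 'g) \<Rightarrow> 'g gword \<Rightarrow> 'g" where
  "geval G \<sigma> (GVar i) = \<sigma> i"
| "geval G \<sigma> (GConst c) = c"
| "geval G \<sigma> GOne = \<one>\<^bsub>G\<^esub>"
| "geval G \<sigma> (GMul u v) = geval G \<sigma> u \<otimes>\<^bsub>G\<^esub> geval G \<sigma> v"
| "geval G \<sigma> (GInv u) = inv\<^bsub>G\<^esub> (geval G \<sigma> u)"

definition algebraically_closed :: "'g set \<Rightarrow> 'g monoid \<Rightarrow> bool" where
  "algebraically_closed H G \<longleftrightarrow>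
     (\<forall>E :: 'g gword list. (\<forall>e\<in>set E. gconsts e \<subseteq> H) \<longrightarrow>
        (\<exists>\<sigma>. range \<sigma> \<subseteq> carrier G \<and> (\<forall>e\<in>set E. geval G \<sigma> e = \<one>\<^bsub>G\<^esub>)) \<longrightarrow>
        (\<exists>\<sigma>. range \<sigma> \<subseteq> H \<and> (\<forall>e\<in>set E. geval G \<sigma> e = \<one>\<^bsub>G\<^esub>)))"

definition verbally_closed :: "'g set \<Rightarrow> 'g monoid \<Rightarrow> bool" where
  "verbally_closed H G \<longleftrightarrow>
     (\<forall>w :: 'g gword. \<forall>h\<in>H. gconsts w = {} \<longrightarrow>
        ((\<exists>\<sigma>. range \<sigma> \<subseteq> carrier G \<and> geval G \<sigma> w = h) \<longleftrightarrow>
         (\<exists>\<sigma>. range \<sigma> \<subseteq> H \<and> geval G \<sigma> w = h)))"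

end

theory Submission
  imports Defs "HOL-Computational_Algebra.Polynomial" "HOL-Library.Countable"
begin

text \<open>
  Only the implication from verbally closed to retract is substantial. Writing an element \<open>h\<close> of a
  verbally closed subgroup \<open>H\<close> as a word in the basis of \<open>G\<close> and solving that word equation in \<open>H\<close>
  gives a homomorphism \<open>G \<rightarrow> H\<close> that fixes \<open>h\<close>. In particular \<open>H \<inter> G' = H'\<close>.

  If the images of \<open>g\<close> and \<open>f\<close> in \<open>G/G' = \<int>\<^sup>r\<close> are linearly dependent, the Euclidean algorithm replaces
  them by generators \<open>c, d\<close> of \<open>H\<close> with \<open>d \<in> G'\<close>. Then \<open>d \<in> H'\<close>, and since \<open>H'\<close> is the normal closure
  of \<open>[c, d]\<close>, \<open>d\<close> lies in all terms of the lower central series. As \<open>G\<close> is residually nilpotent,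
  \<open>d = 1\<close>, and a homomorphism \<open>G \<rightarrow> H\<close> that fixes \<open>c\<close> is a retraction onto \<open>H = \<langle>c\<rangle>\<close>.

  If they are independent, take \<open>\<phi> : G \<rightarrow> H\<close> that fixes \<open>[g, f]\<close>. Comparing images of \<open>[g, f]\<close> in the
  Heisenberg group shows that \<open>\<phi>\<close> acts on \<open>H/H'\<close> with determinant 1. It is therefore onto modulo
  \<open>H'\<close>, and onto because \<open>H'\<close> is the normal closure of \<open>[g, f]\<close> and abelian. Some \<open>\<psi> : G \<rightarrow> H\<close> inverts
  it modulo \<open>H'\<close>; then \<open>\<psi> \<circ> \<phi>\<close> is the identity on all lower central factors of \<open>H\<close>, so
  \<open>\<phi>\<close> is injective on \<open>H\<close> by residual nilpotence. The inverse of \<open>\<phi>\<close> on \<open>H\<close>, composed with \<open>\<phi>\<close>, is a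
  retraction.

  For the free metabelian group, residual nilpotence comes from flows on the Cayley graph of \<open>\<int>\<^sup>r\<close>:
  an element of \<open>G'\<close> is trivial as soon as its word traverses every edge equally often in both
  directions. A nonzero flow is detected by a homomorphism to a group of affine maps
  \<open>y \<mapsto> q powi m * y + b\<close> with odd \<open>q\<close>, whose lower central series is controlled by the powers of 2.
\<close>

abbreviation commutator :: "('a, 'b) monoid_scheme \<Rightarrow> 'a \<Rightarrow> 'a \<Rightarrow> 'a" where
  "commutator G x y \<equiv> x \<otimes>\<^bsub>G\<^esub> y \<otimes>\<^bsub>G\<^esub> inv\<^bsub>G\<^esub> x \<otimes>\<^bsub>G\<^esub> inv\<^bsub>G\<^esub> y"

section \<open>Commutators and the lower central series\<close>

lemma (in group) inv_mult_cancel [simp]: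
  assumes "x \<in> carrier G" "y \<in> carrier G"
  shows "inv x \<otimes> (x \<otimes> y) = y" "x \<otimes> (inv x \<otimes> y) = y"
  using assms by (simp_all add: m_assoc[symmetric])

lemma (in group) normal_commutator_closed:
  assumes N: "N \<lhd> G" and "x \<in> N" "y \<in> carrier G"
  shows "commutator G x y \<in> N" "commutator G y x \<in> N"
proof -
  interpret N: normal N G by fact
  have x: "x \<in> carrier G" using assms N.subset by auto
  have "x \<otimes> (y \<otimes> inv x \<otimes> inv y) \<in> N"
    using assms by (intro N.m_closed N.inv_op_closed2) auto
  then show "commutator G x y \<in> N" using x assms by (simp add: m_assoc)
  have "(y \<otimes> x \<otimes> inv y) \<otimes> inv x \<in> N"
    using assms by (intro N.m_closed N.inv_op_closed2) auto
  moreover have "commutator G y x = y \<otimes> x \<otimes> inv y \<otimes> inv x" by simp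
  ultimately show "commutator G y x \<in> N" by simp
qed

lemma (in group) inv_commutator:
  assumes "x \<in> carrier G" "y \<in> carrier G"
  shows "inv (commutator G x y) = commutator G y x"
  using assms by (simp add: m_assoc inv_mult_group)

lemma (in group) commutator_eq_one_iff:
  assumes "x \<in> carrier G" "y \<in> carrier G"
  shows "commutator G x y = \<one> \<longleftrightarrow> x \<otimes> y = y \<otimes> x"
proof
  assume "commutator G x y = \<one>"
  then have "commutator G x y \<otimes> (y \<otimes> x) = y \<otimes> x" using assms by simp
  then show "x \<otimes> y = y \<otimes> x" using assms by (simp add: m_assoc)
next
  assume "x \<otimes> y = y \<otimes> x"
  then show "commutator G x y = \<one>" using assms by (simp add: m_assoc)
qed

lemma (in group) commutator_swap_mem:
  assumes "subgroup N G" "x \<in> carrier G" "y \<in> carrier G" "commutator G x y \<in> N"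
  shows "commutator G y x \<in> N"
  using subgroup.m_inv_closed[OF assms(1,4)] inv_commutator[OF assms(2,3)] by simp

text \<open>Closure follows from [xz, y] = (x [z, y] x^-1) [x, y] and [x^-1, y] = x^-1 [x, y]^-1 x,
  where normality keeps the conjugates in \<open>N\<close>.\<close>

lemma (in group) commuting_mod_subgroup:
  assumes N: "N \<lhd> G" and y: "y \<in> carrier G"
  shows "subgroup {x \<in> carrier G. commutator G x y \<in> N} G"
proof (rule subgroupI)
  interpret N: normal N G by fact
  show "{x \<in> carrier G. commutator G x y \<in> N} \<noteq> {}"
    using y by (auto intro!: exI[of _ \<one>])
  fix x assume x: "x \<in> {x \<in> carrier G. commutator G x y \<in> N}"
  have "inv x \<otimes> inv (commutator G x y) \<otimes> x \<in> N"
    using x by (intro N.inv_op_closed1) auto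
  then show "inv x \<in> {x \<in> carrier G. commutator G x y \<in> N}"
    using x y by (simp add: m_assoc inv_mult_group)
  fix z assume z: "z \<in> {x \<in> carrier G. commutator G x y \<in> N}"
  have "(x \<otimes> commutator G z y \<otimes> inv x) \<otimes> commutator G x y \<in> N"
    using x z N.m_closed[OF N.inv_op_closed2[of x "commutator G z y"], of "commutator G x y"] by auto
  then show "x \<otimes> z \<in> {x \<in> carrier G. commutator G x y \<in> N}"
    using x y z by (simp add: m_assoc inv_mult_group)
qed auto

text \<open>Commuting modulo \<open>N\<close> with a fixed element is a subgroup condition, so it is
  enough to check generators in one argument and then in the other. Among g and f the only
  nontrivial pair is (g, f), up to inversion.\<close>

lemma (in group) derived_subset_normal_closure:
  assumes N: "N \<lhd> G" and "g \<in> carrier G" "f \<in> carrier G"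
    and gen: "generate G {g, f} = carrier G" and c: "commutator G g f \<in> N"
  shows "derived G (carrier G) \<subseteq> N"
proof -
  interpret N: normal N G by fact
  have S: "subgroup N G" by (rule N.subgroup_axioms)
  have 1: "commutator G x y \<in> N" if "y \<in> carrier G" "commutator G g y \<in> N" "commutator G f y \<in> N"
    "x \<in> carrier G" for x y
    using generate_subgroup_incl[OF _ commuting_mod_subgroup[OF N that(1)], of "{g, f}"] assms that
    unfolding gen by auto
  have "commutator G x g \<in> N" "commutator G x f \<in> N" if "x \<in> carrier G" for x
    using 1[of g x] 1[of f x] that assms commutator_swap_mem[OF S, of g f] N.one_closed
      commutator_eq_one_iff[of g g] commutator_eq_one_iff[of f f] by auto
  then have 2: "commutator G g x \<in> N" "commutator G f x \<in> N" if "x \<in> carrier G" for x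
    using that assms(2,3) commutator_swap_mem[OF S, of x g] commutator_swap_mem[OF S, of x f] by simp_all
  have "derived_set G (carrier G) \<subseteq> N"
    using 1 2 by auto
  then show ?thesis
    unfolding derived_def using generate_subgroup_incl[OF _ S] by blast
qed

lemma lower_central_1: "lower_central G (Suc 0) = derived G (carrier G)"
  unfolding derived_def lower_central.simps by (rule arg_cong[where f = "generate G"]) auto

text \<open>Constants such as \<^const>\<open>lower_central\<close> are only defined for unextended monoid records, whereas
  the type of \<open>G\<close> in \<^locale>\<open>group\<close> is an arbitrary extension.\<close>

locale plain_group = group G for G :: "'a monoid" (structure)

declare lower_central.simps(2) [simp del]

lemma (in plain_group) lower_central_normal: "lower_central G n \<lhd> G"
proof (induction n)
  case 0
  show ?case by (simp add: normal_self)
next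
  case (Suc n)
  interpret N: normal "lower_central G n" G by fact
  show ?case unfolding lower_central.simps
  proof (rule normal_generateI)
    show "{commutator G a b | a b. a \<in> lower_central G n \<and> b \<in> carrier G} \<subseteq> carrier G"
      using N.subset by auto
    fix h g assume "h \<in> {commutator G a b | a b. a \<in> lower_central G n \<and> b \<in> carrier G}"
      and g: "g \<in> carrier G"
    then obtain x y where h: "h = commutator G x y" "x \<in> lower_central G n" "y \<in> carrier G"
      by auto
    have x: "x \<in> carrier G" using h N.subset by auto
    have "g \<otimes> h \<otimes> inv g = commutator G (g \<otimes> x \<otimes> inv g) (g \<otimes> y \<otimes> inv g)"
      using g h x by (simp add: m_assoc inv_mult_group)
    moreover have "g \<otimes> x \<otimes> inv g \<in> lower_central G n" "g \<otimes> y \<otimes> inv g \<in> carrier G"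
      using g h by (auto intro: N.inv_op_closed2)
    ultimately show "g \<otimes> h \<otimes> inv g \<in> {commutator G a b | a b. a \<in> lower_central G n \<and> b \<in> carrier G}"
      by blast
  qed
qed

lemma (in plain_group) lower_central_subset: "lower_central G n \<subseteq> carrier G"
  using lower_central_normal[of n] normal_imp_subgroup subgroup.subset by blast

lemma (in plain_group) commutator_lower_central:
  assumes "x \<in> lower_central G n" "y \<in> carrier G"
  shows "commutator G x y \<in> lower_central G (Suc n)" "commutator G y x \<in> lower_central G (Suc n)"
proof -
  show "commutator G x y \<in> lower_central G (Suc n)"
    unfolding lower_central.simps using assms by (auto intro!: generate.incl)
  then show "commutator G y x \<in> lower_central G (Suc n)"
    using commutator_swap_mem[OF normal_imp_subgroup[OF lower_central_normal], of x y "Suc n"]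
      assms lower_central_subset by blast
qed

lemma (in plain_group) lower_central_decreasing: "lower_central G (Suc n) \<subseteq> lower_central G n"
  unfolding lower_central.simps
  using normal_commutator_closed(1)[OF lower_central_normal[of n]]
  by (intro generate_subgroup_incl[OF _ normal_imp_subgroup[OF lower_central_normal]]) blast

lemma (in plain_group) lower_central_subset_derived: "lower_central G (Suc n) \<subseteq> derived G (carrier G)"
proof (induction n)
  case (Suc n)
  then show ?case using lower_central_decreasing[of "Suc n"] by (rule order_trans[rotated])
qed (simp add: lower_central_1)

lemma (in plain_group) lower_central_of_subgroup:
  assumes "subgroup H G"
  shows "lower_central (G\<lparr>carrier := H\<rparr>) n \<subseteq> lower_central G n"
proof (induction n)
  case 0
  show ?case using assms subgroup.subset by simp
next
  case (Suc n)
  interpret K: plain_group "G\<lparr>carrier := H\<rparr>"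
    unfolding plain_group_def by (rule subgroup_imp_group[OF assms])
  let ?C = "{commutator (G\<lparr>carrier := H\<rparr>) x y | x y. x \<in> lower_central (G\<lparr>carrier := H\<rparr>) n \<and> y \<in> H}"
  have HG: "H \<subseteq> carrier G" using assms subgroup.subset by auto
  have LH: "lower_central (G\<lparr>carrier := H\<rparr>) n \<subseteq> H"
    using K.lower_central_subset by auto
  have C: "?C \<subseteq> H"
  proof safe
    fix x y assume "x \<in> lower_central (G\<lparr>carrier := H\<rparr>) n" "y \<in> H"
    with LH have "x \<in> H" by auto
    with \<open>y \<in> H\<close> show "commutator (G\<lparr>carrier := H\<rparr>) x y \<in> H"
      using K.m_closed K.inv_closed by simp
  qed
  have "?C \<subseteq> lower_central G (Suc n)"
  proof safe
    fix x y assume x: "x \<in> lower_central (G\<lparr>carrier := H\<rparr>) n" and y: "y \<in> H"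
    with LH have "x \<in> H" by auto
    then have "commutator (G\<lparr>carrier := H\<rparr>) x y = commutator G x y"
      using assms y by (simp add: m_inv_consistent)
    then show "commutator (G\<lparr>carrier := H\<rparr>) x y \<in> lower_central G (Suc n)"
      using commutator_lower_central(1)[of x n y] x y Suc HG by auto
  qed
  then have "generate G ?C \<subseteq> lower_central G (Suc n)"
    by (intro generate_subgroup_incl normal_imp_subgroup lower_central_normal)
  then show ?case
    using generate_consistent[OF C assms] by (simp add: lower_central.simps)
qed

text \<open>Commutators lift entrywise through a surjection. This transfers a nilpotency bound from
  a test group to its copies.\<close>

lemma lower_central_img:
  fixes G :: "'a monoid" and H :: "'b monoid"
  assumes "group_hom G H h" and onto: "h ` carrier G = carrier H"
  shows "lower_central H n = h ` lower_central G n"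
proof (induction n)
  case 0
  show ?case using onto by simp
next
  case (Suc n)
  interpret group_hom G H h by fact
  interpret G: plain_group G unfolding plain_group_def by (rule G.is_group)
  let ?C = "\<lambda>G. {commutator G x y | x y. x \<in> lower_central G n \<and> y \<in> carrier G}"
  have sub: "x \<in> carrier G" if "x \<in> lower_central G n" for x
    using that G.lower_central_subset by auto
  have com: "h (commutator G x y) = commutator H (h x) (h y)"
    if "x \<in> carrier G" "y \<in> carrier G" for x y
    using that by simp
  have "?C H = h ` ?C G"
  proof
    show "?C H \<subseteq> h ` ?C G"
    proof safe
      fix x y assume "x \<in> lower_central H n" "y \<in> carrier H"
      then obtain x' y' where "x = h x'" "x' \<in> lower_central G n" "y = h y'" "y' \<in> carrier G"
        using Suc onto by (metis imageE)
      then show "commutator H x y \<in> h ` ?C G"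
        using com[of x' y'] sub by (intro image_eqI[of _ _ "commutator G x' y'"]) auto
    qed
    show "h ` ?C G \<subseteq> ?C H"
    proof safe
      fix x y assume "x \<in> lower_central G n" "y \<in> carrier G"
      then show "\<exists>u v. h (commutator G x y) = commutator H u v \<and> u \<in> lower_central H n \<and> v \<in> carrier H"
        using com[of x y] sub Suc by (intro exI[of _ "h x"] exI[of _ "h y"]) auto
    qed
  qed
  moreover have "?C G \<subseteq> carrier G" using sub by auto
  ultimately show ?case using generate_img[of "?C G"] by (simp add: lower_central.simps)
qed

section \<open>Endomorphisms congruent to the identity modulo the derived subgroup\<close>

lemma (in group) mod_fixed_subgroup:
  assumes N: "N \<lhd> G" and \<eta>: "\<eta> \<in> hom G G"
  shows "subgroup {x \<in> carrier G. \<eta> x \<otimes> inv x \<in> N} G"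
proof (rule subgroupI)
  interpret N: normal N G by fact
  interpret \<eta>: group_hom G G \<eta> using \<eta> by unfold_locales
  show "{x \<in> carrier G. \<eta> x \<otimes> inv x \<in> N} \<noteq> {}"
    by (auto intro!: exI[of _ \<one>])
  fix x assume x: "x \<in> {x \<in> carrier G. \<eta> x \<otimes> inv x \<in> N}"
  have "inv (\<eta> x) \<otimes> inv (\<eta> x \<otimes> inv x) \<otimes> \<eta> x \<in> N"
    using x by (intro N.inv_op_closed1) auto
  then show "inv x \<in> {x \<in> carrier G. \<eta> x \<otimes> inv x \<in> N}"
    using x by (simp add: m_assoc inv_mult_group)
  fix y assume y: "y \<in> {x \<in> carrier G. \<eta> x \<otimes> inv x \<in> N}"
  \<comment> \<open>After cancellation this product is the defect
    \<open>\<eta> (x \<otimes> y) \<otimes> inv (x \<otimes> y)\<close>.\<close>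
  have "(\<eta> x \<otimes> (\<eta> y \<otimes> inv y) \<otimes> inv (\<eta> x)) \<otimes> (\<eta> x \<otimes> inv x) \<in> N"
    using x y N.m_closed[OF N.inv_op_closed2[of "\<eta> x" "\<eta> y \<otimes> inv y"], of "\<eta> x \<otimes> inv x"] by auto
  then show "x \<otimes> y \<in> {x \<in> carrier G. \<eta> x \<otimes> inv x \<in> N}"
    using x y by (simp add: m_assoc inv_mult_group)
qed auto

text \<open>A generator [u, v] of the next term is sent by \<eta> to [zu, yv], with z one term
  deeper than u and y in the derived subgroup. When this commutator is expanded, every correction
  factor lands in the term after that of [u, v].\<close>

lemma (in plain_group) mod_derived_fixed_lower_central:
  assumes metab: "\<And>x y. x \<in> derived G (carrier G) \<Longrightarrow> y \<in> derived G (carrier G) \<Longrightarrow> x \<otimes> y = y \<otimes> x"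
    and \<eta>: "\<eta> \<in> hom G G"
    and fixed: "\<And>x. x \<in> carrier G \<Longrightarrow> \<eta> x \<otimes> inv x \<in> derived G (carrier G)"
    and "x \<in> lower_central G n"
  shows "\<eta> x \<otimes> inv x \<in> lower_central G (Suc n)"
  using assms(4)
proof (induction n arbitrary: x)
  case 0
  then show ?case using fixed by (simp only: lower_central_1) simp
next
  case (Suc n)
  interpret \<eta>: group_hom G G \<eta> using \<eta> by unfold_locales
  let ?N = "lower_central G (Suc (Suc n))"
  have N: "?N \<lhd> G" by (rule lower_central_normal)
  note N_mult = subgroup.m_closed[OF normal_imp_subgroup[OF N]]
    and N_conj = normal.inv_op_closed2[OF N]
  have sub: "u \<in> carrier G" if "u \<in> lower_central G m" for u m
    using that lower_central_subset by blast
  have "commutator G u v \<in> {x \<in> carrier G. \<eta> x \<otimes> inv x \<in> ?N}"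
    if u: "u \<in> lower_central G n" and v: "v \<in> carrier G" for u v
  proof -
    define z y t where "z = \<eta> u \<otimes> inv u" and "y = \<eta> v \<otimes> inv v" and "t = commutator G u v"
    have uc: "u \<in> carrier G" using u sub by blast
    have z: "z \<in> lower_central G (Suc n)" unfolding z_def using Suc.IH[OF u] .
    have zc: "z \<in> carrier G" using z sub by blast
    have y: "y \<in> derived G (carrier G)" unfolding y_def by (rule fixed[OF v])
    have y1: "y \<in> lower_central G (Suc 0)" using y by (simp only: lower_central_1)
    have yc: "y \<in> carrier G" using y1 sub by blast
    have t: "t \<in> lower_central G (Suc n)"
      unfolding t_def using commutator_lower_central(1)[OF u v] .
    have tc: "t \<in> carrier G" using t sub by blast
    have uz: "\<eta> u = z \<otimes> u" and vy: "\<eta> v = y \<otimes> v"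
      unfolding z_def y_def using uc v by (simp_all add: m_assoc)
    have yt: "y \<otimes> t = t \<otimes> y"
      using metab[OF y] t lower_central_subset_derived by blast
    \<comment> \<open>For n = 0 the derived element y alone supplies the extra depth. For n > 0 both
      u and y lie in the abelian derived subgroup, and the commutator is trivial.\<close>
    have n1: "commutator G u y \<in> ?N"
    proof (cases n)
      case 0
      then show ?thesis using commutator_lower_central(2)[OF y1 uc] by simp
    next
      case (Suc m)
      then have "u \<otimes> y = y \<otimes> u"
        using u y metab lower_central_subset_derived by blast
      then show ?thesis using commutator_eq_one_iff[OF uc yc] subgroup.one_closed[OF normal_imp_subgroup[OF N]] by simp
    qed
    have "\<eta> t = commutator G (z \<otimes> u) (y \<otimes> v)"
      unfolding t_def using uc v by (simp only: uz[symmetric] vy[symmetric]) simp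
    also have "\<dots> = z \<otimes> commutator G u (y \<otimes> v) \<otimes> inv z \<otimes> commutator G z (y \<otimes> v)"
      using uc v zc yc by (simp add: m_assoc inv_mult_group)
    also have "commutator G u (y \<otimes> v) = commutator G u y \<otimes> (y \<otimes> t \<otimes> inv y)"
      unfolding t_def using uc v yc by (simp add: m_assoc inv_mult_group)
    also have "y \<otimes> t \<otimes> inv y = t"
      unfolding yt using tc yc by (simp add: m_assoc)
    finally have "\<eta> t \<otimes> inv t = (z \<otimes> commutator G u y \<otimes> inv z) \<otimes> commutator G z t \<otimes>
        (t \<otimes> commutator G z (y \<otimes> v) \<otimes> inv t)"
      using uc v yc zc tc by (simp add: m_assoc inv_mult_group)
    also have "\<dots> \<in> ?N"
      using n1 commutator_lower_central(1)[OF z tc] commutator_lower_central(1)[OF z, of "y \<otimes> v"]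
        zc tc yc v
      by (intro N_mult[OF N_mult[OF N_conj]] N_conj) auto
    finally show ?thesis using tc by (simp add: t_def)
  qed
  then have "lower_central G (Suc n) \<subseteq> {x \<in> carrier G. \<eta> x \<otimes> inv x \<in> ?N}"
    unfolding lower_central.simps(2)[of G n]
    by (intro generate_subgroup_incl mod_fixed_subgroup N \<eta>) blast
  then show ?case using Suc.prems by blast
qed

text \<open>If \<open>\<eta> x = \<one>\<close>, the defect of x is its inverse, so lying in one
  term forces x into the next. This turns residual nilpotence into injectivity.\<close>

lemma (in plain_group) trivial_kernel_of_mod_derived_fixed:
  assumes metab: "\<And>x y. x \<in> derived G (carrier G) \<Longrightarrow> y \<in> derived G (carrier G) \<Longrightarrow> x \<otimes> y = y \<otimes> x"
    and \<eta>: "\<eta> \<in> hom G G"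
    and fixed: "\<And>x. x \<in> carrier G \<Longrightarrow> \<eta> x \<otimes> inv x \<in> derived G (carrier G)"
    and x: "x \<in> carrier G" "\<eta> x = \<one>"
  shows "x \<in> lower_central G n"
proof (induction n)
  case (Suc n)
  have "inv x \<in> lower_central G (Suc n)"
    using mod_derived_fixed_lower_central[OF metab \<eta> fixed Suc] x by simp
  then have "inv (inv x) \<in> lower_central G (Suc n)"
    by (rule subgroup.m_inv_closed[OF normal_imp_subgroup[OF lower_central_normal]])
  then show ?case unfolding inv_inv[OF x(1)] .
qed (use x in simp)

lemma (in group) image_mod_subgroup:
  assumes N: "N \<lhd> G" and \<eta>: "\<eta> \<in> hom G G"
  shows "subgroup {x \<in> carrier G. \<exists>y\<in>carrier G. \<eta> y \<otimes> inv x \<in> N} G" (is "subgroup ?S G")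
proof (rule subgroupI)
  interpret N: normal N G by fact
  interpret \<eta>: group_hom G G \<eta> using \<eta> by unfold_locales
  show "?S \<noteq> {}"
    by (auto intro!: exI[of _ \<one>] bexI[of _ \<one>])
  fix x assume "x \<in> ?S"
  then obtain u where x: "x \<in> carrier G" "u \<in> carrier G" "\<eta> u \<otimes> inv x \<in> N" by auto
  have "inv (\<eta> u) \<otimes> inv (\<eta> u \<otimes> inv x) \<otimes> \<eta> u \<in> N"
    using x N.inv_op_closed1[of "\<eta> u" "inv (\<eta> u \<otimes> inv x)"] by simp
  then have "\<eta> (inv u) \<otimes> inv (inv x) \<in> N"
    using x by (simp add: m_assoc inv_mult_group)
  then show "inv x \<in> ?S" using x by blast
  fix y assume "y \<in> ?S"
  then obtain v where y: "y \<in> carrier G" "v \<in> carrier G" "\<eta> v \<otimes> inv y \<in> N" by auto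
  have "(\<eta> u \<otimes> (\<eta> v \<otimes> inv y) \<otimes> inv (\<eta> u)) \<otimes> (\<eta> u \<otimes> inv x) \<in> N"
    using x y N.m_closed[OF N.inv_op_closed2[of "\<eta> u" "\<eta> v \<otimes> inv y"], of "\<eta> u \<otimes> inv x"] by auto
  then have "\<eta> (u \<otimes> v) \<otimes> inv (x \<otimes> y) \<in> N"
    using x y by (simp add: m_assoc inv_mult_group)
  then show "x \<otimes> y \<in> ?S" using x y by blast
qed auto

text \<open>Let L be the image and D the derived subgroup. The two approximations give G = DL.
  Conjugation by L preserves L \<inter> D, and conjugation by D is trivial on it because D is
  abelian, so L \<inter> D is normal. It contains [g, f], hence all of D, and L = G follows.\<close>

lemma (in group) surjective_if_commutator_fixed:
  assumes metab: "\<And>x y. x \<in> derived G (carrier G) \<Longrightarrow> y \<in> derived G (carrier G) \<Longrightarrow> x \<otimes> y = y \<otimes> x"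
    and \<theta>: "\<theta> \<in> hom G G"
    and gf: "g \<in> carrier G" "f \<in> carrier G" and gen: "generate G {g, f} = carrier G"
    and c: "\<theta> (commutator G g f) = commutator G g f"
    and "\<exists>y\<in>carrier G. \<theta> y \<otimes> inv g \<in> derived G (carrier G)"
    and "\<exists>y\<in>carrier G. \<theta> y \<otimes> inv f \<in> derived G (carrier G)"
  shows "\<theta> ` carrier G = carrier G"
proof -
  interpret \<theta>: group_hom G G \<theta> using \<theta> by unfold_locales
  define D L where "D = derived G (carrier G)" and "L = \<theta> ` carrier G"
  have D: "D \<lhd> G" unfolding D_def by (rule derived_self_is_normal)
  have L: "subgroup L G" unfolding L_def by (rule \<theta>.img_is_subgroup)
  note DS = normal_imp_subgroup[OF D]
  note mem = subgroup.mem_carrier[OF DS] subgroup.mem_carrier[OF L]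
  have approx: "generate G {g, f} \<subseteq> {x \<in> carrier G. \<exists>y\<in>carrier G. \<theta> y \<otimes> inv x \<in> D}"
    using assms(7,8) gf unfolding D_def[symmetric]
    by (intro generate_subgroup_incl[OF _ image_mod_subgroup[OF D \<theta>]]) auto
  have dec: "\<exists>l\<in>L. \<exists>z\<in>D. x = z \<otimes> l" if "x \<in> carrier G" for x
  proof -
    from that approx obtain y where y: "y \<in> carrier G" "\<theta> y \<otimes> inv x \<in> D"
      unfolding gen by auto
    have "inv (\<theta> y \<otimes> inv x) \<in> D" using y by (intro subgroup.m_inv_closed[OF DS])
    moreover have "x = inv (\<theta> y \<otimes> inv x) \<otimes> \<theta> y"
      using y that by (simp add: inv_mult_group m_assoc)
    ultimately show ?thesis using y unfolding L_def by blast
  qed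
  have "L \<inter> D \<lhd> G"
  proof (rule normal_invI)
    show "subgroup (L \<inter> D) G" using L DS by (rule subgroups_Inter_pair)
    fix x n assume x: "x \<in> carrier G" and n: "n \<in> L \<inter> D"
    obtain l z where lz: "l \<in> L" "z \<in> D" "x = z \<otimes> l" using dec[OF x] by auto
    note c = mem(2)[OF lz(1)] mem(1)[OF lz(2)]
    define n' where "n' = l \<otimes> n \<otimes> inv l"
    have n': "n' \<in> L" "n' \<in> D"
      unfolding n'_def using n lz(1) L c
      by (auto intro!: subgroup.m_closed[OF L] subgroup.m_inv_closed[OF L] normal.inv_op_closed2[OF D])
    have nc: "n \<in> carrier G" using n mem by blast
    have n'c: "n' \<in> carrier G" using n' mem by blast
    have "x \<otimes> n \<otimes> inv x = z \<otimes> n' \<otimes> inv z"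
      unfolding lz(3) n'_def using c nc by (simp add: m_assoc inv_mult_group)
    also have "z \<otimes> n' = n' \<otimes> z" using metab lz(2) n'(2) unfolding D_def by blast
    also have "n' \<otimes> z \<otimes> inv z = n'" using c n'c by (simp add: m_assoc)
    finally show "x \<otimes> n \<otimes> inv x \<in> L \<inter> D" using n' by simp
  qed
  moreover have "commutator G g f \<in> L"
    unfolding L_def using c gf by (intro image_eqI[of _ _ "commutator G g f"]) auto
  moreover have "commutator G g f \<in> D"
    unfolding D_def derived_def using gf by (intro generate.incl) auto
  ultimately have "D \<subseteq> L"
    using derived_subset_normal_closure[OF _ gf gen] unfolding D_def by blast
  have "carrier G \<subseteq> L"
  proof
    fix x assume "x \<in> carrier G"
    with dec obtain l z where "l \<in> L" "z \<in> D" "x = z \<otimes> l" by blast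
    then show "x \<in> L" using \<open>D \<subseteq> L\<close> subgroup.m_closed[OF L, of z l] by blast
  qed
  then show ?thesis using subgroup.subset[OF L] unfolding L_def by (rule subset_antisym[rotated])
qed

section \<open>Exponents\<close>

text \<open>Integer unitriangular 3x3 matrices with superdiagonal (a, b) and corner c. The corner of
  a commutator is a 2x2 determinant, so this group detects minors of exponent vectors.\<close>

definition heisenberg :: "(int \<times> int \<times> int) monoid" where
  "heisenberg = \<lparr>carrier = UNIV,
     monoid.mult = (\<lambda>(a, b, c) (a', b', c'). (a + a', b + b', c + c' + a * b')), one = (0, 0, 0)\<rparr>"

lemma heisenberg_simps [simp]:
  "carrier heisenberg = UNIV"
  "(a, b, c) \<otimes>\<^bsub>heisenberg\<^esub> (a', b', c') = (a + a', b + b', c + c' + a * b')"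
  "\<one>\<^bsub>heisenberg\<^esub> = (0, 0, 0)"
  by (simp_all add: heisenberg_def)

lemma group_heisenberg: "group heisenberg"
proof (rule groupI)
  fix x y z :: "int \<times> int \<times> int"
  show "x \<otimes>\<^bsub>heisenberg\<^esub> y \<otimes>\<^bsub>heisenberg\<^esub> z = x \<otimes>\<^bsub>heisenberg\<^esub> (y \<otimes>\<^bsub>heisenberg\<^esub> z)"
    by (cases x; cases y; cases z) (simp add: algebra_simps)
  show "\<one>\<^bsub>heisenberg\<^esub> \<otimes>\<^bsub>heisenberg\<^esub> x = x"
    by (cases x) simp
  obtain p q s where "x = (p, q, s)" by (cases x)
  then show "\<exists>y\<in>carrier heisenberg. y \<otimes>\<^bsub>heisenberg\<^esub> x = \<one>\<^bsub>heisenberg\<^esub>"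
    by (intro bexI[of _ "(-p, -q, p * q - s)"]) auto
qed auto

lemma inv_heisenberg [simp]: "inv\<^bsub>heisenberg\<^esub> (a, b, c) = (-a, -b, a * b - c)"
  by (rule group.inv_equality[OF group_heisenberg]) auto

lemma commutator_heisenberg:
  "commutator heisenberg (a, b, c) (a', b', c') = (0, 0, a * b' - a' * b)"
  by (simp add: algebra_simps)

text \<open>What the argument takes from relative freeness, in a form shared by the metabelian and
  the nilpotent case. Two kinds of target for maps of the basis are common to both: subgroups of
  \<open>G\<close> and the Heisenberg group. Residual nilpotence, which has a different reason in
  each case, is added in a later locale.\<close>

locale based_metabelian_group = plain_group G for G :: "'a monoid" (structure) +
  fixes a :: "nat \<Rightarrow> 'a" and r :: nat
  assumes derived_commute:
      "x \<in> derived G (carrier G) \<Longrightarrow> y \<in> derived G (carrier G) \<Longrightarrow> x \<otimes> y = y \<otimes> x"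
    and basis_closed: "i < r \<Longrightarrow> a i \<in> carrier G"
    and basis_generates: "generate G (a ` {..<r}) = carrier G"
    and hom_into_subgroup: "subgroup H G \<Longrightarrow> (\<And>i. i < r \<Longrightarrow> b i \<in> H) \<Longrightarrow>
      \<exists>\<phi>\<in>hom G (G\<lparr>carrier := H\<rparr>). \<forall>i<r. \<phi> (a i) = b i"
    and hom_into_heisenberg: "\<exists>h\<in>hom G heisenberg. \<forall>i<r. h (a i) = (\<alpha> i, \<beta> i, 0)"
begin

lemma basis_induct [consumes 1, case_names one basis inv_basis mult]:
  assumes "x \<in> carrier G" and "P \<one>" and "\<And>i. i < r \<Longrightarrow> P (a i)" and "\<And>i. i < r \<Longrightarrow> P (inv (a i))"
    and "\<And>x y. x \<in> carrier G \<Longrightarrow> y \<in> carrier G \<Longrightarrow> P x \<Longrightarrow> P y \<Longrightarrow> P (x \<otimes> y)"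
  shows "P x"
proof -
  have "x \<in> generate G (a ` {..<r})" using assms(1) basis_generates by simp
  then show ?thesis
  proof induction
    case (eng h1 h2)
    then show ?case using assms(5) unfolding basis_generates by blast
  qed (use assms in auto)
qed

lemma hom_eq_on_basis:
  assumes "group K" and \<phi>: "\<phi> \<in> hom G K" and \<psi>: "\<psi> \<in> hom G K" and "\<And>i. i < r \<Longrightarrow> \<phi> (a i) = \<psi> (a i)"
    and x: "x \<in> carrier G"
  shows "\<phi> x = \<psi> x"
proof -
  interpret K: group K by fact
  interpret \<phi>: group_hom G K \<phi> using \<phi> by unfold_locales
  interpret \<psi>: group_hom G K \<psi> using \<psi> by unfold_locales
  show ?thesis using x
    by (induction rule: basis_induct) (use assms(4) basis_closed in simp_all)
qed

text \<open>The exponent sum of \<open>a i\<close>, a coordinate of the abelianization. Existence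
  comes from the first coordinate of a homomorphism to the Heisenberg group. For i >= r it vanishes
  on the carrier.\<close>

definition expo :: "nat \<Rightarrow> 'a \<Rightarrow> int" where
  "expo i = (SOME e. (\<forall>x\<in>carrier G. \<forall>y\<in>carrier G. e (x \<otimes> y) = e x + e y) \<and>
     (\<forall>j<r. e (a j) = (if j = i then 1 else 0)))"

lemma expo_exists:
  "\<exists>e. (\<forall>x\<in>carrier G. \<forall>y\<in>carrier G. e (x \<otimes> y) = e x + (e y :: int)) \<and>
     (\<forall>j<r. e (a j) = (if j = i then 1 else 0))"
proof -
  obtain h where h: "h \<in> hom G heisenberg" "\<forall>j<r. h (a j) = (if j = i then 1 else 0, 0, 0)"
    using hom_into_heisenberg[of "\<lambda>j. if j = i then 1 else 0" "\<lambda>j. 0"] by auto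
  have "fst (h (x \<otimes> y)) = fst (h x) + fst (h y)" if "x \<in> carrier G" "y \<in> carrier G" for x y
    using hom_mult[OF h(1) that] by (cases "h x"; cases "h y") simp
  then show ?thesis using h(2) by (intro exI[of _ "\<lambda>x. fst (h x)"]) auto
qed

lemma expo_mult [simp]: "x \<in> carrier G \<Longrightarrow> y \<in> carrier G \<Longrightarrow> expo i (x \<otimes> y) = expo i x + expo i y"
  and expo_basis: "j < r \<Longrightarrow> expo i (a j) = (if j = i then 1 else 0)"
  using someI_ex[OF expo_exists[of i]] unfolding expo_def[symmetric] by auto

lemma expo_one [simp]: "expo i \<one> = 0"
  using expo_mult[of \<one> \<one> i] by simp

lemma expo_inv [simp]: "x \<in> carrier G \<Longrightarrow> expo i (inv x) = - expo i x"
  using expo_mult[of x "inv x" i] by simp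

lemma expo_nat_pow: "x \<in> carrier G \<Longrightarrow> expo i (x [^] (n::nat)) = int n * expo i x"
  by (induction n) (simp_all add: algebra_simps)

lemma expo_int_pow [simp]: "x \<in> carrier G \<Longrightarrow> expo i (x [^] (n::int)) = n * expo i x"
  by (cases n rule: int_cases2) (simp_all add: int_pow_int int_pow_neg_int expo_nat_pow)

lemma expo_derived: "x \<in> derived G (carrier G) \<Longrightarrow> expo i x = 0"
proof -
  assume x: "x \<in> derived G (carrier G)"
  have "subgroup {x \<in> carrier G. expo i x = 0} G"
    by (rule subgroupI) auto
  moreover have "derived_set G (carrier G) \<subseteq> {x \<in> carrier G. expo i x = 0}" by auto
  ultimately show ?thesis
    using generate_subgroup_incl x unfolding derived_def by blast
qed

text \<open>In the abelian quotient by the derived subgroup, the coset of x is the product of the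
  cosets of the \<open>a i\<close> raised to \<open>expo i x\<close>: both sides are multiplicative
  and agree on the basis. Vanishing exponents make that product trivial.\<close>

lemma derived_if_expo_zero:
  assumes x: "x \<in> carrier G" and "\<And>i. i < r \<Longrightarrow> expo i x = 0"
  shows "x \<in> derived G (carrier G)"
proof -
  define D where "D = derived G (carrier G)"
  interpret D: normal D G unfolding D_def by (rule derived_self_is_normal)
  interpret Q: comm_group "G Mod D" unfolding D_def by (rule derived_quot_is_comm_group)
  have Qm: "(D #> u) \<otimes>\<^bsub>G Mod D\<^esub> (D #> v) = D #> (u \<otimes> v)" if "u \<in> carrier G" "v \<in> carrier G" for u v
    using D.rcos_sum[OF that] by (simp add: FactGroup_def)
  have Qc: "D #> u \<in> carrier (G Mod D)" if "u \<in> carrier G" for u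
    using that by (auto simp: FactGroup_def RCOSETS_def)
  have Q1: "D #> \<one> = \<one>\<^bsub>G Mod D\<^esub>"
    using coset_mult_one[OF D.subset] by (simp add: FactGroup_def)
  have ac: "D #> a i \<in> carrier (G Mod D)" if "i < r" for i using Qc basis_closed that by blast
  let ?p = "\<lambda>y. finprod (G Mod D) (\<lambda>i. (D #> a i) [^]\<^bsub>G Mod D\<^esub> expo i y) {..<r}"
  have pm: "?p (u \<otimes> v) = ?p u \<otimes>\<^bsub>G Mod D\<^esub> ?p v" if "u \<in> carrier G" "v \<in> carrier G" for u v
  proof -
    have "?p (u \<otimes> v) = finprod (G Mod D) (\<lambda>i. (D #> a i) [^]\<^bsub>G Mod D\<^esub> expo i u
        \<otimes>\<^bsub>G Mod D\<^esub> (D #> a i) [^]\<^bsub>G Mod D\<^esub> expo i v) {..<r}"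
      using that by (intro Q.finprod_cong'[OF refl] funcsetI Q.m_closed Q.int_pow_closed ac)
        (auto simp: Q.int_pow_mult ac)
    also have "\<dots> = ?p u \<otimes>\<^bsub>G Mod D\<^esub> ?p v"
      using ac by (intro Q.finprod_multf) auto
    finally show ?thesis .
  qed
  have p1: "?p \<one> = \<one>\<^bsub>G Mod D\<^esub>"
    by (simp add: Q.finprod_one_eqI)
  have pc: "?p u \<in> carrier (G Mod D)" for u
    using ac by (intro Q.finprod_closed) auto
  have pa: "?p (a j) = D #> a j" if "j < r" for j
  proof -
    have "?p (a j) = finprod (G Mod D) (\<lambda>i. if j = i then D #> a i else \<one>\<^bsub>G Mod D\<^esub>) {..<r}"
      using that ac Q.one_closed by (intro Q.finprod_cong') (auto simp: expo_basis Q.int_pow_1)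
    also have "\<dots> = D #> a j"
      using that ac by (intro Q.finprod_singleton) auto
    finally show ?thesis .
  qed
  have "D #> x = ?p x" using x
  proof (induction rule: basis_induct)
    case (inv_basis i)
    have "?p (a i) \<otimes>\<^bsub>G Mod D\<^esub> ?p (inv (a i)) = \<one>\<^bsub>G Mod D\<^esub>"
      using pm[of "a i" "inv (a i)"] basis_closed[OF inv_basis] p1 by simp
    moreover have "?p (a i) \<otimes>\<^bsub>G Mod D\<^esub> (D #> inv (a i)) = \<one>\<^bsub>G Mod D\<^esub>"
      unfolding pa[OF inv_basis] using Qm[of "a i" "inv (a i)"] basis_closed[OF inv_basis] Q1 by simp
    ultimately have "?p (a i) \<otimes>\<^bsub>G Mod D\<^esub> (D #> inv (a i)) = ?p (a i) \<otimes>\<^bsub>G Mod D\<^esub> ?p (inv (a i))"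
      by (simp only:)
    then show ?case
      using Qc[of "inv (a i)"] basis_closed[OF inv_basis]
      by (intro Q.l_cancel[OF _ _ pc pc]) simp_all
  next
    case (mult u v)
    have "D #> (u \<otimes> v) = (D #> u) \<otimes>\<^bsub>G Mod D\<^esub> (D #> v)" using mult(1,2) by (rule Qm[symmetric])
    also have "\<dots> = ?p u \<otimes>\<^bsub>G Mod D\<^esub> ?p v" by (simp only: mult(3,4))
    also have "\<dots> = ?p (u \<otimes> v)" using mult(1,2) by (rule pm[symmetric])
    finally show ?case .
  qed (use Q1 p1 pa in auto)
  also have "?p x = \<one>\<^bsub>G Mod D\<^esub>"
    using assms(2) by (intro Q.finprod_one_eqI) simp
  finally have "D #> x = D" by (simp add: FactGroup_def)
  then show ?thesis
    using rcos_self[OF x D.subgroup_axioms] unfolding D_def by simp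
qed

text \<open>A homomorphism to the Heisenberg group puts the exponents i and j on the superdiagonal.
  The corner entry of the image of a commutator is then the minor, which therefore depends on the
  commutator alone.\<close>

lemma minor_eq_if_commutator_eq:
  assumes "x \<in> carrier G" "y \<in> carrier G" "x' \<in> carrier G" "y' \<in> carrier G"
    and eq: "commutator G x y = commutator G x' y'" and ij: "i < r" "j < r"
  shows "expo i x * expo j y - expo i y * expo j x = expo i x' * expo j y' - expo i y' * expo j x'"
proof -
  obtain h where h: "h \<in> hom G heisenberg"
    "\<forall>l<r. h (a l) = (if l = i then 1 else 0, if l = j then 1 else 0, 0)"
    using hom_into_heisenberg[of "\<lambda>l. if l = i then 1 else 0" "\<lambda>l. if l = j then 1 else 0"] by auto
  interpret H: group heisenberg by (rule group_heisenberg)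
  interpret h: group_hom G heisenberg h using h(1) by unfold_locales
  have 1: "\<exists>c. h x = (expo i x, expo j x, c)" if "x \<in> carrier G" for x using that
  proof (induction rule: basis_induct)
    case (inv_basis l)
    then show ?case using h(2) basis_closed by (auto simp: expo_basis)
  next
    case (mult x y)
    then show ?case by auto
  qed (use h(2) in \<open>auto simp: expo_basis\<close>)
  have 2: "h (commutator G x y) = (0, 0, expo i x * expo j y - expo i y * expo j x)"
    if xy: "x \<in> carrier G" "y \<in> carrier G" for x y
  proof -
    have "h (commutator G x y) = commutator heisenberg (h x) (h y)" using xy by simp
    then show ?thesis
      using 1[OF xy(1)] 1[OF xy(2)] by (auto simp only: commutator_heisenberg)
  qed
  show ?thesis using 2[of x y] 2[of x' y'] assms by simp
qed

section \<open>Verbally closed subgroups\<close>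

text \<open>One word has to serve all endomorphisms at once: on the basis it evaluates to x, and on
  a solution in a subgroup it evaluates to the image of x under the homomorphism that the solution
  defines.\<close>

lemma word_exists:
  assumes "x \<in> carrier G"
  shows "\<exists>w :: 'a gword. gconsts w = {} \<and>
    (\<forall>\<phi>\<in>hom G G. \<forall>\<sigma>. (\<forall>i<r. \<sigma> i = \<phi> (a i)) \<longrightarrow> geval G \<sigma> w = \<phi> x)"
  using assms
proof (induction rule: basis_induct)
  case one
  show ?case by (rule exI[of _ GOne]) (simp add: hom_one is_group)
next
  case (basis i)
  then show ?case by (intro exI[of _ "GVar i"]) simp
next
  case (inv_basis i)
  have "\<phi> (inv (a i)) = inv (\<phi> (a i))" if "\<phi> \<in> hom G G" for \<phi>
  proof -
    interpret group_hom G G \<phi> using that by unfold_locales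
    show ?thesis using basis_closed[OF inv_basis] by simp
  qed
  then show ?case using inv_basis by (intro exI[of _ "GInv (GVar i)"]) simp
next
  case (mult x y)
  then obtain v w :: "'a gword" where
    "gconsts v = {}" "\<forall>\<phi>\<in>hom G G. \<forall>\<sigma>. (\<forall>i<r. \<sigma> i = \<phi> (a i)) \<longrightarrow> geval G \<sigma> v = \<phi> x"
    "gconsts w = {}" "\<forall>\<phi>\<in>hom G G. \<forall>\<sigma>. (\<forall>i<r. \<sigma> i = \<phi> (a i)) \<longrightarrow> geval G \<sigma> w = \<phi> y"
    by blast
  with mult(1,2) show ?case by (intro exI[of _ "GMul v w"]) (simp add: hom_mult)
qed

lemma hom_subgroupD:
  assumes "subgroup H G" "\<phi> \<in> hom G (G\<lparr>carrier := H\<rparr>)"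
  shows "\<phi> \<in> hom G G" "x \<in> carrier G \<Longrightarrow> \<phi> x \<in> H"
proof -
  show 1: "\<phi> x \<in> H" if "x \<in> carrier G" for x
    using hom_in_carrier[OF assms(2) that] by simp
  show "\<phi> \<in> hom G G"
  proof (rule homI)
    fix x y assume xy: "x \<in> carrier G" "y \<in> carrier G"
    show "\<phi> x \<in> carrier G" using subgroup.mem_carrier[OF assms(1) 1[OF xy(1)]] .
    show "\<phi> (x \<otimes> y) = \<phi> x \<otimes> \<phi> y" using hom_mult[OF assms(2) xy] by simp
  qed
qed

lemma verbally_closed_fixing_hom:
  assumes H: "subgroup H G" and vc: "verbally_closed H G" and x: "x \<in> H"
  shows "\<exists>\<phi>\<in>hom G (G\<lparr>carrier := H\<rparr>). \<phi> x = x"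
proof -
  have xc: "x \<in> carrier G" by (rule subgroup.mem_carrier[OF H x])
  obtain w :: "'a gword" where w: "gconsts w = {}"
    "\<And>\<phi> \<sigma>. \<phi> \<in> hom G G \<Longrightarrow> (\<And>i. i < r \<Longrightarrow> \<sigma> i = \<phi> (a i)) \<Longrightarrow> geval G \<sigma> w = \<phi> x"
    using word_exists[OF xc] by blast
  have id: "(\<lambda>x. x) \<in> hom G G" by (auto simp: hom_def)
  \<comment> \<open>The basis itself solves the equation in \<open>G\<close>. Variables from index r
    on, which the assignment must also cover, get the value \<open>\<one>\<close>.\<close>
  have "geval G (\<lambda>i. if i < r then a i else \<one>) w = x"
    by (rule w(2)[OF id]) simp
  moreover have "range (\<lambda>i. if i < r then a i else \<one>) \<subseteq> carrier G"
    using basis_closed by auto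
  ultimately obtain \<sigma> where \<sigma>: "range \<sigma> \<subseteq> H" "geval G \<sigma> w = x"
    using vc w(1) x unfolding verbally_closed_def by blast
  have "\<sigma> i \<in> H" for i using \<sigma>(1) by auto
  then obtain \<phi> where \<phi>: "\<phi> \<in> hom G (G\<lparr>carrier := H\<rparr>)" "\<forall>i<r. \<phi> (a i) = \<sigma> i"
    using hom_into_subgroup[OF H, of \<sigma>] by auto
  have "geval G \<sigma> w = \<phi> x"
    using w(2)[OF hom_subgroupD(1)[OF H \<phi>(1)], of \<sigma>] \<phi>(2) by simp
  then show ?thesis using \<sigma>(2) \<phi>(1) by (intro bexI[of _ \<phi>]) auto
qed

section \<open>Nielsen moves and the Euclidean algorithm\<close>

lemma generate_pair_eqI:
  assumes "g \<in> carrier G" "f \<in> carrier G" "u \<in> carrier G" "v \<in> carrier G"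
    and "u \<in> generate G {g, f}" "v \<in> generate G {g, f}" "g \<in> generate G {u, v}" "f \<in> generate G {u, v}"
  shows "generate G {u, v} = generate G {g, f}"
  using assms generate_subgroup_incl[OF _ generate_is_subgroup, of "{u, v}" "{g, f}"]
    generate_subgroup_incl[OF _ generate_is_subgroup, of "{g, f}" "{u, v}"] by auto

lemma generate_pair_shear:
  assumes "g \<in> carrier G" "f \<in> carrier G"
  shows "generate G {g \<otimes> f, f} = generate G {g, f}" "generate G {g \<otimes> inv f, f} = generate G {g, f}"
proof -
  have 1: "g \<in> generate G {g, f}" "f \<in> generate G {g, f}" "f \<in> generate G {h, f}" "h \<in> generate G {h, f}" for h
    by (auto intro: generate.incl)
  have 2: "inv f \<in> generate G {h, f}" for h by (rule generate.inv) simp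
  have "(g \<otimes> f) \<otimes> inv f \<in> generate G {g \<otimes> f, f}" "(g \<otimes> inv f) \<otimes> f \<in> generate G {g \<otimes> inv f, f}"
    using 1 2 by (auto intro: generate.eng)
  then have 3: "g \<in> generate G {g \<otimes> f, f}" "g \<in> generate G {g \<otimes> inv f, f}"
    using assms by (simp_all add: m_assoc)
  show "generate G {g \<otimes> f, f} = generate G {g, f}" "generate G {g \<otimes> inv f, f} = generate G {g, f}"
    using assms 1 2 3 by (intro generate_pair_eqI; auto intro: generate.eng)+
qed

text \<open>Replacing g by gf or gf^-1 changes the relation coefficients (p, q) to (p, q - p) or (p,
  q + p); the signs decide which move lowers |p| + |q|, and the roles are exchanged when |q| < |p|.
  Once one coefficient is 0 the other is not, and the generator it belongs to has zero
  exponents.\<close>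

lemma euclid_generators:
  assumes "g \<in> carrier G" "f \<in> carrier G" "p \<noteq> 0 \<or> q \<noteq> 0"
    and "\<And>i. i < r \<Longrightarrow> p * expo i g + q * expo i f = 0"
  shows "\<exists>c\<in>carrier G. \<exists>d\<in>carrier G. generate G {c, d} = generate G {g, f} \<and> (\<forall>i<r. expo i d = 0)"
  using assms
proof (induction "nat \<bar>p\<bar> + nat \<bar>q\<bar>" arbitrary: p q g f rule: less_induct)
  case less
  have swap: "generate G {f, g} = generate G {g, f}" by (simp add: insert_commute)
  consider "p = 0" | "q = 0" | "p \<noteq> 0" "q \<noteq> 0" "\<bar>p\<bar> \<le> \<bar>q\<bar>" | "p \<noteq> 0" "q \<noteq> 0" "\<bar>q\<bar> < \<bar>p\<bar>" by linarith
  then show ?case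
  proof cases
    case 1
    then have "\<forall>i<r. expo i f = 0" using less.prems by auto
    then show ?thesis using less.prems by blast
  next
    case 2
    then have "\<forall>i<r. expo i g = 0" using less.prems by auto
    then show ?thesis using less.prems swap by blast
  next
    case 3
    show ?thesis
    proof (cases "sgn p = sgn q")
      case True
      have lt: "nat \<bar>p\<bar> + nat \<bar>q - p\<bar> < nat \<bar>p\<bar> + nat \<bar>q\<bar>" using 3 True by (auto simp: sgn_if split: if_splits)
      have "p * expo i (g \<otimes> f) + (q - p) * expo i f = 0" if "i < r" for i
        using less.prems(4)[OF that] less.prems(1,2) by (simp add: algebra_simps)
      from less.hyps[OF lt _ less.prems(2) _ this] show ?thesis
        using less.prems(1,2) 3 generate_pair_shear(1) by simp
    next
      case False
      have lt: "nat \<bar>p\<bar> + nat \<bar>q + p\<bar> < nat \<bar>p\<bar> + nat \<bar>q\<bar>" using 3 False by (auto simp: sgn_if split: if_splits)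
      have "p * expo i (g \<otimes> inv f) + (q + p) * expo i f = 0" if "i < r" for i
        using less.prems(4)[OF that] less.prems(1,2) by (simp add: algebra_simps)
      from less.hyps[OF lt _ less.prems(2) _ this] show ?thesis
        using less.prems(1,2) 3 generate_pair_shear(2) by simp
    qed
  next
    case 4
    show ?thesis
    proof (cases "sgn p = sgn q")
      case True
      have lt: "nat \<bar>q\<bar> + nat \<bar>p - q\<bar> < nat \<bar>p\<bar> + nat \<bar>q\<bar>" using 4 True by (auto simp: sgn_if split: if_splits)
      have "q * expo i (f \<otimes> g) + (p - q) * expo i g = 0" if "i < r" for i
        using less.prems(4)[OF that] less.prems(1,2) by (simp add: algebra_simps)
      from less.hyps[OF lt _ less.prems(1) _ this] show ?thesis
        using less.prems(1,2) 4 generate_pair_shear(1)[of f g] swap by simp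
    next
      case False
      have lt: "nat \<bar>q\<bar> + nat \<bar>p + q\<bar> < nat \<bar>p\<bar> + nat \<bar>q\<bar>" using 4 False by (auto simp: sgn_if split: if_splits)
      have "q * expo i (f \<otimes> inv g) + (p + q) * expo i g = 0" if "i < r" for i
        using less.prems(4)[OF that] less.prems(1,2) by (simp add: algebra_simps)
      from less.hyps[OF lt _ less.prems(1) _ this] show ?thesis
        using less.prems(1,2) 4 generate_pair_shear(2)[of f g] swap by simp
    qed
  qed
qed

end

locale residually_nilpotent_based_group = based_metabelian_group +
  assumes residually_nilpotent: "(\<And>n. x \<in> lower_central G n) \<Longrightarrow> x = \<one>"
begin

section \<open>Subgroups whose elements are each fixed by some homomorphism from \<open>G\<close>
  into the subgroup\<close>

context
  fixes H :: "'a set"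
  assumes H: "subgroup H G"
    and fixing_hom: "\<And>x. x \<in> H \<Longrightarrow> \<exists>\<phi>\<in>hom G (G\<lparr>carrier := H\<rparr>). \<phi> x = x"
begin

interpretation K: plain_group "G\<lparr>carrier := H\<rparr>"
  unfolding plain_group_def by (rule subgroup_imp_group[OF H])

lemma subgroup_derived: "derived (G\<lparr>carrier := H\<rparr>) H = derived G H"
  by (rule derived_consistent[OF _ H]) simp

lemma subgroup_derived_commute:
  assumes "x \<in> derived G H" "y \<in> derived G H"
  shows "x \<otimes> y = y \<otimes> x"
  using derived_commute assms mono_derived[OF subgroup.subset[OF H]] by blast

text \<open>x lies in the derived subgroup of \<open>G\<close>, which any homomorphism into
  \<open>H\<close> sends into the derived subgroup of \<open>H\<close>. The homomorphism that fixes
  x therefore shows that x lies there.\<close>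

lemma derived_subgroup_if_expo_zero:
  assumes x: "x \<in> H" and "\<And>i. i < r \<Longrightarrow> expo i x = 0"
  shows "x \<in> derived G H"
proof -
  obtain \<phi> where \<phi>: "\<phi> \<in> hom G (G\<lparr>carrier := H\<rparr>)" "\<phi> x = x"
    using fixing_hom[OF x] by auto
  interpret \<phi>: group_hom G "G\<lparr>carrier := H\<rparr>" \<phi> using \<phi>(1) by unfold_locales
  have "x \<in> derived G (carrier G)"
    using derived_if_expo_zero[OF subgroup.mem_carrier[OF H x]] assms(2) .
  then have "\<phi> x \<in> derived (G\<lparr>carrier := H\<rparr>) (\<phi> ` carrier G)"
    unfolding \<phi>.derived_img[OF order_refl] by (rule imageI)
  moreover have "derived (G\<lparr>carrier := H\<rparr>) (\<phi> ` carrier G) \<subseteq> derived (G\<lparr>carrier := H\<rparr>) H"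
    using hom_subgroupD(2)[OF H \<phi>(1)] by (intro K.mono_derived) auto
  ultimately show ?thesis unfolding subgroup_derived \<phi>(2) by blast
qed

text \<open>Descent along the lower central series of \<open>H\<close>: if d lies in one term,
  [c, d] lies in the next, and so does its normal closure, which contains the derived subgroup of
  \<open>H\<close> and hence d.\<close>

lemma cyclic_if_expo_zero:
  assumes cd: "c \<in> carrier G" "d \<in> carrier G" and gen: "generate G {c, d} = H"
    and "\<And>i. i < r \<Longrightarrow> expo i d = 0"
  shows "generate G {c} = H"
proof -
  have cH: "c \<in> H" and dH: "d \<in> H" unfolding gen[symmetric] by (auto intro: generate.incl)
  have d: "d \<in> derived (G\<lparr>carrier := H\<rparr>) H"
    using derived_subgroup_if_expo_zero[OF dH assms(4)] subgroup_derived by simp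
  have genK: "generate (G\<lparr>carrier := H\<rparr>) {c, d} = carrier (G\<lparr>carrier := H\<rparr>)"
    using generate_consistent[OF _ H, of "{c, d}"] cH dH gen by simp
  have "d \<in> lower_central (G\<lparr>carrier := H\<rparr>) n" for n
  proof (induction n)
    case 0
    show ?case using dH by simp
  next
    case (Suc n)
    have "commutator (G\<lparr>carrier := H\<rparr>) c d \<in> lower_central (G\<lparr>carrier := H\<rparr>) (Suc n)"
      using K.commutator_lower_central(2)[OF Suc, of c] cH by simp
    from K.derived_subset_normal_closure[OF K.lower_central_normal _ _ genK this] show ?case
      using cH dH d by auto
  qed
  then have "d = \<one>"
    using lower_central_of_subgroup[OF H] by (intro residually_nilpotent) blast
  then have "generate G {c, d} = generate G {c}"
    using cd generate_subgroup_incl[OF _ generate_is_subgroup[of "{c}"], of "{c, \<one>}"]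
      mono_generate[of "{c}" "{c, \<one>}"] generate.one[of G "{c}"] generate.incl[of c "{c}" G] by blast
  then show ?thesis using gen by simp
qed

lemma cyclic_retract:
  assumes "c \<in> carrier G" "generate G {c} = H"
  shows "retract H G"
proof -
  have "c \<in> H" unfolding assms(2)[symmetric] by (auto intro: generate.incl)
  then obtain \<phi> where \<phi>: "\<phi> \<in> hom G (G\<lparr>carrier := H\<rparr>)" "\<phi> c = c"
    using fixing_hom by auto
  interpret \<phi>: group_hom G G \<phi> using hom_subgroupD(1)[OF H \<phi>(1)] by unfold_locales
  have "subgroup {x \<in> carrier G. \<phi> x = x} G"
    by (rule subgroupI) auto
  then have "H \<subseteq> {x \<in> carrier G. \<phi> x = x}"
    unfolding assms(2)[symmetric] using \<phi>(2) assms(1) by (intro generate_subgroup_incl) auto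
  then show ?thesis unfolding retract_def using H \<phi>(1) by blast
qed

lemma retract_if_minors_vanish:
  assumes gf: "g \<in> carrier G" "f \<in> carrier G" and gen: "generate G {g, f} = H"
    and minors: "\<And>i j. i < r \<Longrightarrow> j < r \<Longrightarrow> expo i g * expo j f = expo i f * expo j g"
  shows "retract H G"
proof -
  have "\<exists>p q. (p \<noteq> 0 \<or> q \<noteq> 0) \<and> (\<forall>i<r. p * expo i g + q * expo i f = 0)"
  proof (cases "\<exists>j<r. expo j g \<noteq> 0 \<or> expo j f \<noteq> 0")
    case True
    then obtain j where "j < r" "expo j g \<noteq> 0 \<or> expo j f \<noteq> 0" by blast
    \<comment> \<open>The nonzero exponent pair at j supplies the coefficients; the vanishing of all
      minors that involve j says that they annihilate the pair at every i.\<close>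
    then show ?thesis
      using minors by (intro exI[of _ "expo j f"] exI[of _ "- expo j g"]) (auto simp: algebra_simps)
  next
    case False
    then show ?thesis by (intro exI[of _ 1] exI[of _ 0]) auto
  qed
  then obtain p q where pq: "p \<noteq> 0 \<or> q \<noteq> 0" "\<And>i. i < r \<Longrightarrow> p * expo i g + q * expo i f = 0"
    by blast
  obtain c d where "c \<in> carrier G" "d \<in> carrier G" "generate G {c, d} = H" "\<forall>i<r. expo i d = 0"
    using euclid_generators[OF gf pq] gen by auto
  then show ?thesis using cyclic_retract[OF _ cyclic_if_expo_zero] by simp
qed

lemma expo_generated:
  assumes gf: "g \<in> carrier G" "f \<in> carrier G" and "x \<in> generate G {g, f}"
  shows "\<exists>m n. \<forall>i. expo i x = m * expo i g + n * expo i f"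
  using assms(3)
proof induction
  case one
  show ?case by (intro exI[of _ 0]) simp
next
  case (incl h)
  then consider "h = g" | "h = f" by blast
  then show ?case
  proof cases
    case 1
    then show ?thesis by (intro exI[of _ 1] exI[of _ 0]) simp
  next
    case 2
    then show ?thesis by (intro exI[of _ 0] exI[of _ 1]) simp
  qed
next
  case (inv h)
  then consider "h = g" | "h = f" by blast
  then show ?case
  proof cases
    case 1
    then show ?thesis using gf by (intro exI[of _ "-1"] exI[of _ 0]) simp
  next
    case 2
    then show ?thesis using gf by (intro exI[of _ 0] exI[of _ "-1"]) simp
  qed
next
  case (eng h1 h2)
  then obtain m n m' n' where "\<forall>i. expo i h1 = m * expo i g + n * expo i f"
    "\<forall>i. expo i h2 = m' * expo i g + n' * expo i f" by blast
  moreover have "h1 \<in> carrier G" "h2 \<in> carrier G"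
    using eng(1,2) generate_in_carrier[of "{g, f}"] gf by blast+
  ultimately show ?case
    by (intro exI[of _ "m + m'"] exI[of _ "n + n'"]) (simp add: algebra_simps)
qed

lemma retract_if_minor_nonzero:
  assumes gf: "g \<in> carrier G" "f \<in> carrier G" and gen: "generate G {g, f} = H"
    and ij: "i0 < r" "j0 < r" and minor: "expo i0 g * expo j0 f \<noteq> expo i0 f * expo j0 g"
  shows "retract H G"
proof -
  have gH: "g \<in> H" and fH: "f \<in> H" unfolding gen[symmetric] by (auto intro: generate.incl)
  have HG: "x \<in> carrier G" if "x \<in> H" for x by (rule subgroup.mem_carrier[OF H that])
  have commH: "commutator G g f \<in> H"
    using gH fH by (intro subgroup.m_closed[OF H] subgroup.m_inv_closed[OF H])
  obtain \<phi> where \<phi>: "\<phi> \<in> hom G (G\<lparr>carrier := H\<rparr>)" "\<phi> (commutator G g f) = commutator G g f"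
    using fixing_hom[OF commH] by auto
  note \<phi>H = hom_subgroupD(2)[OF H \<phi>(1)]
  have \<phi>G: "\<phi> \<in> hom G G" by (rule hom_subgroupD(1)[OF H \<phi>(1)])
  interpret \<phi>: group_hom G G \<phi> using \<phi>G by unfold_locales
  \<comment> \<open>The rows (\<alpha>, \<beta>) and (\<gamma>, \<delta>) form the matrix of \<phi>
    on \<open>H\<close> modulo its derived subgroup, with respect to g and f.\<close>
  obtain \<alpha> \<beta> where g': "expo i (\<phi> g) = \<alpha> * expo i g + \<beta> * expo i f" for i
    using expo_generated[OF gf, of "\<phi> g"] \<phi>H[OF gf(1)] gen by auto
  obtain \<gamma> \<delta> where f': "expo i (\<phi> f) = \<gamma> * expo i g + \<delta> * expo i f" for i
    using expo_generated[OF gf, of "\<phi> f"] \<phi>H[OF gf(2)] gen by auto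
  have "commutator G (\<phi> g) (\<phi> f) = commutator G g f"
    using \<phi>(2) gf by simp
  from minor_eq_if_commutator_eq[OF _ _ gf this ij]
  have "expo i0 (\<phi> g) * expo j0 (\<phi> f) - expo i0 (\<phi> f) * expo j0 (\<phi> g)
      = expo i0 g * expo j0 f - expo i0 f * expo j0 g" using gf by simp
  \<comment> \<open>Passing from g, f to their images multiplies the minor by the determinant of
    this matrix, while fixing [g, f] preserves it.\<close>
  then have "(\<alpha> * \<delta> - \<beta> * \<gamma>) * (expo i0 g * expo j0 f - expo i0 f * expo j0 g)
      = expo i0 g * expo j0 f - expo i0 f * expo j0 g"
    unfolding g' f' by (simp add: algebra_simps)
  then have det: "\<alpha> * \<delta> - \<beta> * \<gamma> = 1" using minor by simp
  \<comment> \<open>Injectivity of \<phi> modulo the derived subgroup of \<open>H\<close>. The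
    exponents of \<open>\<phi> x\<close> combine those of g and f with coefficients p and q;
    Cramer's rule with the nonzero minor gives p = q = 0, and the adjugate matrix then gives m = n =
    0.\<close>
  have reflect: "x \<in> derived G H" if x: "x \<in> H" and x0: "\<And>i. i < r \<Longrightarrow> expo i (\<phi> x) = 0" for x
  proof -
    obtain m n where mn: "expo i x = m * expo i g + n * expo i f" for i
      using expo_generated[OF gf, of x] x gen by auto
    \<comment> \<open>Dividing x by a product of powers with the same exponents leaves an element of
      the derived subgroup, so \<phi> acts on the exponents of x through the matrix.\<close>
    define y where "y = x \<otimes> inv (g [^] m \<otimes> f [^] n)"
    have yc: "y \<in> carrier G" unfolding y_def using HG[OF x] gf by simp
    have "expo i y = 0" for i
      unfolding y_def using HG[OF x] gf by (simp add: mn)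
    then have "y \<in> derived G (carrier G)" using yc by (intro derived_if_expo_zero)
    then have "\<phi> y \<in> derived G (\<phi> ` carrier G)"
      unfolding \<phi>.derived_img[OF order_refl] by (rule imageI)
    moreover have "derived G (\<phi> ` carrier G) \<subseteq> derived G (carrier G)"
      using \<phi>.hom_closed by (intro mono_derived) auto
    ultimately have y0: "expo i (\<phi> y) = 0" for i using expo_derived by blast
    have "expo i (\<phi> y) = expo i (\<phi> x) - (m * expo i (\<phi> g) + n * expo i (\<phi> f))" for i
      using HG[OF x] gf unfolding y_def by (simp add: \<phi>.hom_int_pow)
    then have e: "expo i (\<phi> x) = m * expo i (\<phi> g) + n * expo i (\<phi> f)" for i
      using y0[of i] by simp
    define p q where "p = m * \<alpha> + n * \<gamma>" and "q = m * \<beta> + n * \<delta>"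
    have pq: "p * expo i g + q * expo i f = 0" if "i < r" for i
    proof -
      have "p * expo i g + q * expo i f = expo i (\<phi> x)"
        unfolding e g' f' p_def q_def by (simp only: algebra_simps)
      then show ?thesis using x0[OF that] by simp
    qed
    have "p * (expo i0 g * expo j0 f - expo i0 f * expo j0 g)
        = (p * expo i0 g + q * expo i0 f) * expo j0 f - (p * expo j0 g + q * expo j0 f) * expo i0 f"
      by (simp add: algebra_simps)
    then have "p = 0" using pq ij minor by simp
    have "q * (expo i0 g * expo j0 f - expo i0 f * expo j0 g)
        = (p * expo j0 g + q * expo j0 f) * expo i0 g - (p * expo i0 g + q * expo i0 f) * expo j0 g"
      by (simp add: algebra_simps)
    then have "q = 0" using pq ij minor by simp
    have "m * (\<alpha> * \<delta> - \<beta> * \<gamma>) = p * \<delta> - q * \<gamma>" "n * (\<alpha> * \<delta> - \<beta> * \<gamma>) = q * \<alpha> - p * \<beta>"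
      unfolding p_def q_def by (simp_all add: algebra_simps)
    then have "m = 0" "n = 0" using det \<open>p = 0\<close> \<open>q = 0\<close> by simp_all
    then show ?thesis using mn by (intro derived_subgroup_if_expo_zero[OF x]) simp
  qed
  have \<phi>K: "\<phi> \<in> hom (G\<lparr>carrier := H\<rparr>) (G\<lparr>carrier := H\<rparr>)"
    using \<phi>H HG by (intro homI) simp_all
  have invK: "inv\<^bsub>G\<lparr>carrier := H\<rparr>\<^esub> x = inv x" if "x \<in> H" for x
    using m_inv_consistent[OF H that] .
  have genK: "generate (G\<lparr>carrier := H\<rparr>) {g, f} = carrier (G\<lparr>carrier := H\<rparr>)"
    using generate_consistent[OF _ H, of "{g, f}"] gH fH gen by simp
  have powH: "x [^] (n::int) \<in> H" if "x \<in> H" for x n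
    using that by (rule subgroup_int_pow_closed[OF H])
  have approx: "\<exists>y\<in>H. \<phi> y \<otimes> inv x \<in> derived G H"
    if x: "x \<in> H" and "\<And>i. expo i x = m * expo i (\<phi> g) + n * expo i (\<phi> f)" for x m n
  proof
    show yH: "g [^] m \<otimes> f [^] n \<in> H"
      using powH gH fH by (intro subgroup.m_closed[OF H])
    show "\<phi> (g [^] m \<otimes> f [^] n) \<otimes> inv x \<in> derived G H"
    proof (rule derived_subgroup_if_expo_zero)
      show "\<phi> (g [^] m \<otimes> f [^] n) \<otimes> inv x \<in> H"
        using \<phi>H[OF HG[OF yH]] x by (intro subgroup.m_closed[OF H] subgroup.m_inv_closed[OF H])
      show "expo i (\<phi> (g [^] m \<otimes> f [^] n) \<otimes> inv x) = 0" for i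
        using gf HG[OF x] that(2)[of i] by (simp add: \<phi>.hom_int_pow)
    qed
  qed
  \<comment> \<open>The coefficients \<delta>, -\<beta> here and -\<gamma>, \<alpha> below are the
    rows of the inverse matrix, integral because the determinant is 1.\<close>
  have "\<exists>y\<in>H. \<phi> y \<otimes> inv g \<in> derived G H"
  proof (rule approx[OF gH, of \<delta> "- \<beta>"])
    show "expo i g = \<delta> * expo i (\<phi> g) + - \<beta> * expo i (\<phi> f)" for i
    proof -
      have "\<delta> * expo i (\<phi> g) + - \<beta> * expo i (\<phi> f) = (\<alpha> * \<delta> - \<beta> * \<gamma>) * expo i g"
        unfolding g' f' by (simp add: algebra_simps)
      then show ?thesis using det by simp
    qed
  qed
  moreover have "\<exists>y\<in>H. \<phi> y \<otimes> inv f \<in> derived G H"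
  proof (rule approx[OF fH, of "- \<gamma>" \<alpha>])
    show "expo i f = - \<gamma> * expo i (\<phi> g) + \<alpha> * expo i (\<phi> f)" for i
    proof -
      have "- \<gamma> * expo i (\<phi> g) + \<alpha> * expo i (\<phi> f) = (\<alpha> * \<delta> - \<beta> * \<gamma>) * expo i f"
        unfolding g' f' by (simp add: algebra_simps)
      then show ?thesis using det by simp
    qed
  qed
  ultimately have "\<phi> ` carrier (G\<lparr>carrier := H\<rparr>) = carrier (G\<lparr>carrier := H\<rparr>)"
    using \<phi>(2) gH fH subgroup_derived_commute
    by (intro K.surjective_if_commutator_fixed[OF _ \<phi>K _ _ genK]) (simp_all add: invK subgroup_derived)
  then have onto: "\<phi> ` H = H" by simp
  \<comment> \<open>\<open>a i\<close> need not lie in \<open>H\<close> and so need not have a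
    preimage under \<phi>. But \<open>\<phi> (a i)\<close> lies in \<open>H\<close>, and \<phi>
    \<circ> \<phi> maps \<open>H\<close> onto itself.\<close>
  have "\<exists>u\<in>H. \<phi> (\<phi> u) = \<phi> (a i)" if "i < r" for i
  proof -
    have "\<phi> (a i) \<in> \<phi> ` \<phi> ` H" using \<phi>H[OF basis_closed[OF that]] by (simp only: onto)
    then show ?thesis by auto
  qed
  then obtain u where u: "\<And>i. i < r \<Longrightarrow> u i \<in> H" "\<And>i. i < r \<Longrightarrow> \<phi> (\<phi> (u i)) = \<phi> (a i)"
    by metis
  \<comment> \<open>\<open>\<phi> \<circ> \<phi> \<circ> \<psi> = \<phi>\<close> makes \<open>\<psi>\<close> an inverse of \<open>\<phi>\<close> on \<open>H\<close> modulo the derived subgroup of \<open>H\<close>.\<close>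
  obtain \<psi> where \<psi>: "\<psi> \<in> hom G (G\<lparr>carrier := H\<rparr>)" "\<forall>i<r. \<psi> (a i) = u i"
    using hom_into_subgroup[OF H, of u] u(1) by blast
  note \<psi>H = hom_subgroupD(2)[OF H \<psi>(1)]
  have \<psi>G: "\<psi> \<in> hom G G" by (rule hom_subgroupD(1)[OF H \<psi>(1)])
  interpret \<psi>: group_hom G G \<psi> using \<psi>G by unfold_locales
  have \<phi>\<phi>\<psi>: "\<phi> (\<phi> (\<psi> x)) = \<phi> x" if "x \<in> carrier G" for x
  proof -
    have "(\<lambda>x. \<phi> (\<phi> (\<psi> x))) \<in> hom G G" by (rule homI) auto
    from hom_eq_on_basis[OF is_group this \<phi>G _ that] show ?thesis
      using \<psi>(2) u(2) by simp
  qed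
  have \<eta>K: "(\<lambda>x. \<psi> (\<phi> x)) \<in> hom (G\<lparr>carrier := H\<rparr>) (G\<lparr>carrier := H\<rparr>)"
    using \<psi>H \<phi>H HG by (intro homI) simp_all
  \<comment> \<open>\<phi> \<circ> \<phi> kills the defect w. Two uses of \<open>reflect\<close>,
    one for each \<phi>, bring w itself into the derived subgroup of \<open>H\<close>.\<close>
  have \<eta>_fixed: "\<psi> (\<phi> x) \<otimes> inv x \<in> derived G H" if x: "x \<in> H" for x
  proof -
    note xc = HG[OF x]
    define w where "w = \<psi> (\<phi> x) \<otimes> inv x"
    have w: "w \<in> H" unfolding w_def using x \<psi>H[OF \<phi>.hom_closed[OF xc]]
      by (intro subgroup.m_closed[OF H] subgroup.m_inv_closed[OF H])
    have "\<phi> (\<phi> w) = \<one>"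
      unfolding w_def using xc by (simp add: \<phi>\<phi>\<psi>)
    then have "\<phi> w \<in> derived G H" using w \<phi>H HG by (intro reflect) simp_all
    then have "\<phi> w \<in> derived G (carrier G)" using mono_derived[OF subgroup.subset[OF H]] by blast
    then have "w \<in> derived G H" using w expo_derived by (intro reflect)
    then show ?thesis by (simp add: w_def)
  qed
  have ker: "x = \<one>" if x: "x \<in> H" "\<phi> x = \<one>" for x
  proof (rule residually_nilpotent)
    fix n
    have "x \<in> lower_central (G\<lparr>carrier := H\<rparr>) n"
      using x \<eta>_fixed subgroup_derived_commute
      by (intro K.trivial_kernel_of_mod_derived_fixed[OF _ \<eta>K]) (simp_all add: subgroup_derived invK)
    then show "x \<in> lower_central G n" using lower_central_of_subgroup[OF H] by blast
  qed
  have inj: "inj_on \<phi> H"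
  proof (rule inj_onI)
    fix x y assume xy: "x \<in> H" "y \<in> H" "\<phi> x = \<phi> y"
    have "x \<otimes> inv y \<in> H"
      using xy by (intro subgroup.m_closed[OF H] subgroup.m_inv_closed[OF H])
    moreover have "\<phi> (x \<otimes> inv y) = \<one>" using xy HG by simp
    ultimately have "x \<otimes> inv y = \<one>" by (rule ker)
    then show "x = y" using HG[OF xy(1)] HG[OF xy(2)] inv_equality[of x "inv y"] by simp
  qed
  have "\<phi> \<in> iso (G\<lparr>carrier := H\<rparr>) (G\<lparr>carrier := H\<rparr>)"
    using \<phi>K inj onto by (simp add: iso_def bij_betw_def)
  from K.iso_set_sym[OF this]
  have "inv_into H \<phi> \<in> hom (G\<lparr>carrier := H\<rparr>) (G\<lparr>carrier := H\<rparr>)"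
    by (simp add: iso_def)
  from Group.hom_compose[OF \<phi>(1) this]
  have "inv_into H \<phi> \<circ> \<phi> \<in> hom G (G\<lparr>carrier := H\<rparr>)" .
  then show ?thesis
    unfolding retract_def using H inj by (intro conjI bexI[of _ "inv_into H \<phi> \<circ> \<phi>"]) auto
qed

end

theorem verbally_closed_imp_retract:
  assumes "g \<in> carrier G" "f \<in> carrier G" and vc: "verbally_closed (generate G {g, f}) G"
  shows "retract (generate G {g, f}) G"
proof -
  have H: "subgroup (generate G {g, f}) G"
    using assms(1,2) by (intro generate_is_subgroup) auto
  note fx = verbally_closed_fixing_hom[OF H vc]
  show ?thesis
    using retract_if_minors_vanish[OF H fx assms(1,2) refl]
      retract_if_minor_nonzero[OF H fx assms(1,2) refl] by blast
qed

end

section \<open>Residual nilpotence of free metabelian groups\<close>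

text \<open>The affine maps \<open>y \<mapsto> q powi m * y + b\<close>; the elements that occur form the Baumslag-Solitar
  group \<open>BS(1, q)\<close>.\<close>

definition bs_group :: "rat \<Rightarrow> (int \<times> rat) monoid" where
  "bs_group q = \<lparr>carrier = UNIV, monoid.mult = (\<lambda>(m, b) (n, c). (m + n, b + q powi m * c)), one = (0, 0)\<rparr>"

lemma bs_group_simps [simp]:
  "carrier (bs_group q) = UNIV"
  "(m, b) \<otimes>\<^bsub>bs_group q\<^esub> (n, c) = (m + n, b + q powi m * c)"
  "\<one>\<^bsub>bs_group q\<^esub> = (0, 0)"
  by (simp_all add: bs_group_def)

lemma group_bs_group:
  assumes "q \<noteq> 0"
  shows "group (bs_group q)"
proof (rule groupI)
  fix x y z :: "int \<times> rat"
  show "x \<otimes>\<^bsub>bs_group q\<^esub> y \<otimes>\<^bsub>bs_group q\<^esub> z = x \<otimes>\<^bsub>bs_group q\<^esub> (y \<otimes>\<^bsub>bs_group q\<^esub> z)"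
    using assms by (cases x; cases y; cases z) (simp add: algebra_simps power_int_add)
  show "\<one>\<^bsub>bs_group q\<^esub> \<otimes>\<^bsub>bs_group q\<^esub> x = x"
    by (cases x) simp
  obtain m b where "x = (m, b)" by (cases x)
  then show "\<exists>y\<in>carrier (bs_group q). y \<otimes>\<^bsub>bs_group q\<^esub> x = \<one>\<^bsub>bs_group q\<^esub>"
    by (intro bexI[of _ "(-m, - (q powi (-m) * b))"]) auto
qed auto

lemma inv_bs_group:
  assumes "q \<noteq> 0"
  shows "inv\<^bsub>bs_group q\<^esub> (m, b) = (-m, - (q powi (-m) * b))"
  by (rule group.inv_equality[OF group_bs_group[OF assms]]) auto

lemma commutator_bs_group:
  assumes "q \<noteq> 0"
  shows "commutator (bs_group q) (m, b) (n, c) = (0, (1 - q powi n) * b - (1 - q powi m) * c)"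
proof -
  have 1: "q powi m * q powi (-m) = 1" "q powi n * q powi (-n) = 1"
    using assms by (simp_all add: power_int_minus)
  have 2: "q powi (m + n) * (q powi (-m) * b) = q powi n * b"
    using 1 assms by (simp add: power_int_add)
  show ?thesis
    using 1 2 assms by (auto simp: inv_bs_group algebra_simps)
qed

text \<open>The ideal generated by \<open>2 ^ n\<close> in the ring of fractions whose denominators are powers of \<open>q\<close>.\<close>

definition dyadic_ideal :: "int \<Rightarrow> nat \<Rightarrow> rat set" where
  "dyadic_ideal q n = {b. \<exists>(m::nat) (z::int). b * of_int q ^ m = 2 ^ n * of_int z}"

lemma dyadic_idealI: "b * of_int q ^ m = 2 ^ n * of_int z \<Longrightarrow> b \<in> dyadic_ideal q n"
  unfolding dyadic_ideal_def by blast

lemma of_int_dyadic_ideal: "of_int z \<in> dyadic_ideal q 0"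
  by (rule dyadic_idealI[of _ _ 0]) simp

lemma zero_dyadic_ideal: "0 \<in> dyadic_ideal q n"
  by (rule dyadic_idealI[of _ _ 0 _ 0]) simp

lemma add_dyadic_ideal:
  assumes "b \<in> dyadic_ideal q n" "c \<in> dyadic_ideal q n"
  shows "b + c \<in> dyadic_ideal q n"
proof -
  obtain m z k w where bc: "b * of_int q ^ m = 2 ^ n * of_int z" "c * of_int q ^ k = 2 ^ n * of_int w"
    using assms unfolding dyadic_ideal_def by blast
  have "(b + c) * of_int q ^ (m + k) = (b * of_int q ^ m) * of_int q ^ k + (c * of_int q ^ k) * of_int q ^ m"
    by (simp add: power_add algebra_simps)
  also have "\<dots> = 2 ^ n * of_int (z * q ^ k + w * q ^ m)"
    unfolding bc by (simp add: algebra_simps)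
  finally show ?thesis by (rule dyadic_idealI)
qed

lemma minus_dyadic_ideal:
  assumes "b \<in> dyadic_ideal q n"
  shows "- b \<in> dyadic_ideal q n"
proof -
  obtain m z where "b * of_int q ^ m = 2 ^ n * of_int z"
    using assms unfolding dyadic_ideal_def by blast
  then have "(- b) * of_int q ^ m = 2 ^ n * of_int (- z)" by simp
  then show ?thesis by (rule dyadic_idealI)
qed

lemma powi_mult_dyadic_ideal:
  assumes "b \<in> dyadic_ideal q n" "q \<noteq> 0"
  shows "of_int q powi l * b \<in> dyadic_ideal q n"
proof -
  obtain m z where b: "b * of_int q ^ m = 2 ^ n * of_int z"
    using assms unfolding dyadic_ideal_def by blast
  show ?thesis
  proof (cases l rule: int_cases2)
    case (nonneg k)
    have "of_int q powi l * b * of_int q ^ m = 2 ^ n * of_int (q ^ k * z)"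
      using b nonneg by (simp add: algebra_simps)
    then show ?thesis by (rule dyadic_idealI)
  next
    case (nonpos k)
    have "of_int q powi l * b * of_int q ^ (k + m) = 2 ^ n * of_int z"
      using b nonpos assms(2) by (simp add: power_int_minus power_add field_simps)
    then show ?thesis by (rule dyadic_idealI)
  qed
qed

text \<open>For odd q the number 1 - q^k is even, and a negative exponent changes this factor only
  by a unit. A commutator multiplies a translation by such a factor, so each step down the lower
  central series gains a power of 2.\<close>

lemma one_minus_powi_mult_dyadic_ideal:
  assumes "b \<in> dyadic_ideal q n" "odd q"
  shows "(1 - of_int q powi l) * b \<in> dyadic_ideal q (Suc n)"
proof -
  obtain m z where b: "b * of_int q ^ m = 2 ^ n * of_int z"
    using assms unfolding dyadic_ideal_def by blast
  have q0: "q \<noteq> 0" using assms(2) by auto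
  have step: "(1 - of_int q ^ k) * b \<in> dyadic_ideal q (Suc n)" for k :: nat
  proof -
    have "even (1 - q ^ k)" using assms(2) by simp
    then obtain e where e: "1 - q ^ k = 2 * e" by blast
    have "(1 - of_int q ^ k) * b * of_int q ^ m = of_int (1 - q ^ k) * (b * of_int q ^ m)"
      by simp
    also have "\<dots> = 2 ^ Suc n * of_int (e * z)" unfolding e b by simp
    finally show ?thesis by (rule dyadic_idealI)
  qed
  show ?thesis
  proof (cases l rule: int_cases2)
    case (nonneg k)
    then show ?thesis using step by simp
  next
    case (nonpos k)
    have "(1 - of_int q powi l) * b = of_int q powi l * - ((1 - of_int q ^ k) * b)"
      using nonpos q0 by (simp add: power_int_minus field_simps)
    then show ?thesis
      using powi_mult_dyadic_ideal[OF minus_dyadic_ideal[OF step] q0] by simp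
  qed
qed

text \<open>With b = A/B, membership at level n makes 2^n divide A because q is odd. For nonzero A
  the level n = |A| is already too high.\<close>

lemma Inter_dyadic_ideal:
  assumes "odd q" and "\<And>n. b \<in> dyadic_ideal q n"
  shows "b = 0"
proof (rule ccontr)
  assume "b \<noteq> 0"
  obtain A B where AB: "b = of_int A / of_int B" "B > 0"
    by (metis quotient_of_denom_pos quotient_of_div surj_pair)
  have A: "A \<noteq> 0" using \<open>b \<noteq> 0\<close> AB by auto
  define n where "n = nat \<bar>A\<bar>"
  obtain m z where "b * of_int q ^ m = 2 ^ n * of_int z"
    using assms(2)[of n] unfolding dyadic_ideal_def by blast
  then have "of_int (A * q ^ m) = (of_int (2 ^ n * z * B) :: rat)"
    using AB by (simp add: field_simps)
  then have "A * q ^ m = 2 ^ n * (z * B)" by (simp only: of_int_eq_iff mult.assoc)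
  then have "2 ^ n dvd A * q ^ m" by simp
  moreover have "coprime (2 ^ n) (q ^ m)" using assms(1) by simp
  ultimately have "2 ^ n dvd A" by (simp add: coprime_dvd_mult_left_iff)
  then have "(2::int) ^ n \<le> \<bar>A\<bar>" using A by (intro zdvd_imp_le) simp_all
  moreover have "int n < 2 ^ n" by (metis of_nat_less_two_power)
  ultimately show False unfolding n_def by simp
qed

section \<open>Separating flows on Z^r by evaluation at an odd integer\<close>

lemma sum_list_keys:
  fixes v :: "'k \<Rightarrow> rat"
  assumes "finite S" "fst ` set L \<subseteq> S"
  shows "(\<Sum>(\<alpha>, i)\<leftarrow>L. v \<alpha> * (if i = i0 then 1 else 0)) = (\<Sum>\<alpha>\<in>S. of_nat (count (mset L) (\<alpha>, i0)) * v \<alpha>)"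
  using assms(2)
proof (induction L)
  case (Cons e L)
  obtain \<beta> i where e: "e = (\<beta>, i)" by (cases e)
  have "(\<Sum>\<alpha>\<in>S. of_nat (count (mset (e # L)) (\<alpha>, i0)) * v \<alpha>)
      = (\<Sum>\<alpha>\<in>S. (if \<alpha> = \<beta> then (if i = i0 then v \<alpha> else 0) else 0) + of_nat (count (mset L) (\<alpha>, i0)) * v \<alpha>)"
    by (intro sum.cong) (auto simp: e algebra_simps)
  also have "\<dots> = v \<beta> * (if i = i0 then 1 else 0) + (\<Sum>\<alpha>\<in>S. of_nat (count (mset L) (\<alpha>, i0)) * v \<alpha>)"
    using Cons.prems assms(1) by (simp add: sum.distrib e sum.delta)
  finally show ?case using Cons by (simp add: e)
qed simp

text \<open>The weights are the powers of one integer B. Two points collide only if B is a root of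
  the nonzero polynomial whose coefficients are their coordinate differences, and finitely many
  pairs exclude only finitely many B.\<close>

lemma separating_weights:
  fixes S :: "(nat \<Rightarrow> int) set"
  assumes "finite S" and supp: "\<And>\<alpha> i. \<alpha> \<in> S \<Longrightarrow> i \<ge> r \<Longrightarrow> \<alpha> i = 0"
  shows "\<exists>W :: nat \<Rightarrow> int. inj_on (\<lambda>\<alpha>. \<Sum>i<r. W i * \<alpha> i) S"
proof -
  define p :: "(nat \<Rightarrow> int) \<Rightarrow> (nat \<Rightarrow> int) \<Rightarrow> int poly"
    where "p \<alpha> \<beta> = (\<Sum>i<r. Polynomial.monom (\<alpha> i - \<beta> i) i)" for \<alpha> \<beta>
  have p0: "p \<alpha> \<beta> \<noteq> 0" if "\<alpha> \<in> S" "\<beta> \<in> S" "\<alpha> \<noteq> \<beta>" for \<alpha> \<beta>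
  proof
    assume 0: "p \<alpha> \<beta> = 0"
    have "\<alpha> i = \<beta> i" for i
    proof (cases "i < r")
      case True
      have "Polynomial.coeff (p \<alpha> \<beta>) i = (\<Sum>j<r. if j = i then \<alpha> j - \<beta> j else 0)"
        unfolding p_def by (simp add: Polynomial.coeff_sum)
      also have "\<dots> = \<alpha> i - \<beta> i" using True by simp
      finally show ?thesis using 0 by simp
    next
      case False
      then show ?thesis using supp[OF that(1), of i] supp[OF that(2), of i] by simp
    qed
    then show False using that by auto
  qed
  have "finite (\<Union>\<alpha>\<in>S. \<Union>\<beta>\<in>S - {\<alpha>}. {x. poly (p \<alpha> \<beta>) x = 0})"
    using assms(1) p0 by (intro finite_UN_I poly_roots_finite) auto
  then obtain B where B: "B \<notin> (\<Union>\<alpha>\<in>S. \<Union>\<beta>\<in>S - {\<alpha>}. {x. poly (p \<alpha> \<beta>) x = 0})"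
    using ex_new_if_finite infinite_UNIV_int by blast
  have "inj_on (\<lambda>\<alpha>. \<Sum>i<r. B ^ i * \<alpha> i) S"
  proof (rule inj_onI, rule ccontr)
    fix \<alpha> \<beta> assume ab: "\<alpha> \<in> S" "\<beta> \<in> S" "(\<Sum>i<r. B ^ i * \<alpha> i) = (\<Sum>i<r. B ^ i * \<beta> i)" "\<alpha> \<noteq> \<beta>"
    have "poly (p \<alpha> \<beta>) B = (\<Sum>i<r. B ^ i * \<alpha> i) - (\<Sum>i<r. B ^ i * \<beta> i)"
      unfolding p_def by (simp add: poly_sum poly_monom algebra_simps sum_subtractf)
    then show False using B ab by auto
  qed
  then show ?thesis by blast
qed

text \<open>Fix a label i0 on which the multisets differ. The difference of the two sums is a
  Laurent polynomial in q with net multiplicities as coefficients. Separating weights keep different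
  vertices at different exponents, so it is nonzero and some odd q is not a root.\<close>

lemma separating_evaluation:
  fixes P N :: "((nat \<Rightarrow> int) \<times> nat) list"
  assumes "mset P \<noteq> mset N" and supp: "\<And>\<alpha> i j. (\<alpha>, j) \<in> set P \<union> set N \<Longrightarrow> i \<ge> r \<Longrightarrow> \<alpha> i = 0"
  shows "\<exists>(W :: nat \<Rightarrow> int) (q :: int) i0. odd q \<and>
    (\<Sum>(\<alpha>, i)\<leftarrow>P. of_int q powi (\<Sum>j<r. W j * \<alpha> j) * (if i = i0 then 1 else 0)) \<noteq>
    (\<Sum>(\<alpha>, i)\<leftarrow>N. (of_int q :: rat) powi (\<Sum>j<r. W j * \<alpha> j) * (if i = i0 then 1 else 0))"
proof -
  obtain \<alpha>0 i0 where k0: "count (mset P) (\<alpha>0, i0) \<noteq> count (mset N) (\<alpha>0, i0)"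
    using assms(1) by (metis multiset_eq_iff surj_pair)
  define S where "S = fst ` (set P \<union> set N)"
  have S: "finite S" "fst ` set P \<subseteq> S" "fst ` set N \<subseteq> S" unfolding S_def by auto
  have \<alpha>0: "\<alpha>0 \<in> S"
  proof (rule ccontr)
    assume "\<alpha>0 \<notin> S"
    then have "(\<alpha>0, i0) \<notin> set P \<union> set N"
      using imageI[of "(\<alpha>0, i0)" "set P \<union> set N" fst] unfolding S_def by auto
    then have "count (mset P) (\<alpha>0, i0) = 0" "count (mset N) (\<alpha>0, i0) = 0"
      by (auto simp: count_eq_zero_iff)
    then show False using k0 by linarith
  qed
  have "\<alpha> i = 0" if "\<alpha> \<in> S" "i \<ge> r" for \<alpha> i
  proof -
    from that(1) obtain e where "e \<in> set P \<union> set N" "\<alpha> = fst e" unfolding S_def by blast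
    then have "(\<alpha>, snd e) \<in> set P \<union> set N" by simp
    then show ?thesis by (rule supp[OF _ that(2)])
  qed
  then obtain W :: "nat \<Rightarrow> int" where W: "inj_on (\<lambda>\<alpha>. \<Sum>i<r. W i * \<alpha> i) S"
    using separating_weights[OF S(1), of r] by blast
  define lam where "lam \<alpha> = (\<Sum>i<r. W i * \<alpha> i)" for \<alpha>
  \<comment> \<open>The shift by T makes all exponents nonnegative and turns the Laurent polynomial
    into the polynomial \<open>R\<close>.\<close>
  define T where "T = (\<Sum>\<alpha>\<in>S. \<bar>lam \<alpha>\<bar>)"
  have T: "lam \<alpha> + T \<ge> 0" if "\<alpha> \<in> S" for \<alpha>
  proof -
    have "\<bar>lam \<alpha>\<bar> \<le> T" unfolding T_def using S(1) that by (intro member_le_sum) auto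
    then show ?thesis by linarith
  qed
  define c where "c \<alpha> = (of_nat (count (mset P) (\<alpha>, i0)) - of_nat (count (mset N) (\<alpha>, i0)) :: rat)" for \<alpha>
  define R where "R = (\<Sum>\<alpha>\<in>S. Polynomial.monom (c \<alpha>) (nat (lam \<alpha> + T)))"
  have "Polynomial.coeff R (nat (lam \<alpha>0 + T)) = (\<Sum>\<alpha>\<in>S. if \<alpha> = \<alpha>0 then c \<alpha> else 0)"
    unfolding R_def Polynomial.coeff_sum
  proof (intro sum.cong refl)
    fix \<alpha> assume \<alpha>: "\<alpha> \<in> S"
    have "nat (lam \<alpha> + T) = nat (lam \<alpha>0 + T) \<longleftrightarrow> lam \<alpha> = lam \<alpha>0"
      using T[OF \<alpha>] T[OF \<alpha>0] by (simp add: eq_nat_nat_iff)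
    also have "\<dots> \<longleftrightarrow> \<alpha> = \<alpha>0"
      using W \<alpha> \<alpha>0 unfolding lam_def by (auto dest: inj_onD)
    finally show "Polynomial.coeff (Polynomial.monom (c \<alpha>) (nat (lam \<alpha> + T))) (nat (lam \<alpha>0 + T))
        = (if \<alpha> = \<alpha>0 then c \<alpha> else 0)" by simp
  qed
  also have "\<dots> = c \<alpha>0" using S(1) \<alpha>0 by simp
  also have "\<dots> \<noteq> 0" using k0 by (simp add: c_def)
  finally have "R \<noteq> 0" by auto
  then have "finite {x. poly R x = 0}" by (rule poly_roots_finite)
  moreover have "infinite (range (\<lambda>j::nat. of_int (2 * int j + 1) :: rat))"
    by (intro range_inj_infinite injI) simp
  ultimately obtain j :: nat where j: "poly R (of_int (2 * int j + 1)) \<noteq> 0"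
    by (metis (mono_tags, lifting) finite_subset image_subsetI mem_Collect_eq)
  define q where "q = 2 * int j + 1"
  have q: "odd q" "q \<noteq> 0" unfolding q_def by auto
  have "poly R (of_int q) = (\<Sum>\<alpha>\<in>S. c \<alpha> * (of_int q powi T * of_int q powi lam \<alpha>))"
    unfolding R_def poly_sum poly_monom
  proof (intro sum.cong refl)
    fix \<alpha> assume "\<alpha> \<in> S"
    then have "(of_int q :: rat) ^ nat (lam \<alpha> + T) = of_int q powi (lam \<alpha> + T)"
      using T by (simp add: power_int_def)
    then show "c \<alpha> * of_int q ^ nat (lam \<alpha> + T) = c \<alpha> * (of_int q powi T * of_int q powi lam \<alpha>)"
      using q by (simp add: power_int_add)
  qed
  also have "\<dots> = of_int q powi T * ((\<Sum>\<alpha>\<in>S. of_nat (count (mset P) (\<alpha>, i0)) * of_int q powi lam \<alpha>)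
      - (\<Sum>\<alpha>\<in>S. of_nat (count (mset N) (\<alpha>, i0)) * of_int q powi lam \<alpha>))"
    by (simp add: sum_subtractf[symmetric] sum_distrib_left c_def algebra_simps)
  finally have "(\<Sum>\<alpha>\<in>S. of_nat (count (mset P) (\<alpha>, i0)) * of_int q powi lam \<alpha>) \<noteq>
      (\<Sum>\<alpha>\<in>S. of_nat (count (mset N) (\<alpha>, i0)) * (of_int q :: rat) powi lam \<alpha>)"
    using j by (auto simp: q_def[symmetric])
  then show ?thesis
    unfolding sum_list_keys[OF S(1,2), symmetric] sum_list_keys[OF S(1,3), symmetric] lam_def
    using q(1) by blast
qed

section \<open>Flows on the Cayley graph of the abelianization\<close>

context based_metabelian_group
begin

text \<open>The Cayley graph of the abelianization has vertices \<open>expo_vec x\<close> and an edge labelled \<open>i\<close>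
  leaving each vertex. The lists in \<open>edge_path x P N\<close> collect the edges that a word for \<open>x\<close>
  traverses forwards and backwards; an edge is represented by a group element over its source.\<close>

inductive edge_path :: "'a \<Rightarrow> ('a \<times> nat) list \<Rightarrow> ('a \<times> nat) list \<Rightarrow> bool" where
  edge_path_one: "edge_path \<one> [] []"
| edge_path_basis: "i < r \<Longrightarrow> edge_path (a i) [(\<one>, i)] []"
| edge_path_inv: "i < r \<Longrightarrow> edge_path (inv (a i)) [] [(inv (a i), i)]"
| edge_path_mult: "x \<in> carrier G \<Longrightarrow> y \<in> carrier G \<Longrightarrow> edge_path x P N \<Longrightarrow> edge_path y P' N' \<Longrightarrow>
    edge_path (x \<otimes> y) (P @ map (\<lambda>(u, i). (x \<otimes> u, i)) P') (N @ map (\<lambda>(u, i). (x \<otimes> u, i)) N')"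

lemma edge_path_exists: "x \<in> carrier G \<Longrightarrow> \<exists>P N. edge_path x P N"
  by (induction rule: basis_induct) (blast intro: edge_path.intros)+

lemma edge_path_closed:
  assumes "edge_path x P N"
  shows "x \<in> carrier G" "set P \<union> set N \<subseteq> carrier G \<times> {..<r}"
  using assms by (induction rule: edge_path.induct) (auto intro: basis_closed)

text \<open>The value 0 from index r on lets equality of functions mean equality of the first r
  exponents, and provides the support condition of \<open>separating_evaluation\<close>.\<close>

definition expo_vec :: "'a \<Rightarrow> nat \<Rightarrow> int" where
  "expo_vec x i = (if i < r then expo i x else 0)"

lemma derived_if_expo_vec_eq:
  assumes "x \<in> carrier G" "y \<in> carrier G" "expo_vec x = expo_vec y"
  shows "x \<otimes> inv y \<in> derived G (carrier G)"
proof -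
  have "expo i x = expo i y" if "i < r" for i
    using fun_cong[OF assms(3), of i] that by (simp add: expo_vec_def)
  then show ?thesis
    using assms by (intro derived_if_expo_zero) simp_all
qed

text \<open>A set-theoretic section of the abelianization map: the choice depends on x only through
  its vertex.\<close>

definition section_of :: "'a \<Rightarrow> 'a" where
  "section_of x = (SOME y. y \<in> carrier G \<and> expo_vec y = expo_vec x)"

lemma section_of:
  assumes "x \<in> carrier G"
  shows "section_of x \<in> carrier G" "expo_vec (section_of x) = expo_vec x"
  using someI[of "\<lambda>y. y \<in> carrier G \<and> expo_vec y = expo_vec x" x] assms
  unfolding section_of_def by auto

lemma section_of_cong: "expo_vec x = expo_vec y \<Longrightarrow> section_of x = section_of y"
  by (simp add: section_of_def)

text \<open>The quotient \<open>deviation (x \<otimes> a i) / deviation x\<close> depends only on the vertex of \<open>x\<close>. Hence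
  telescoping along a word expresses the deviation of its value through the flow of the word.\<close>

definition deviation :: "'a \<Rightarrow> 'a" where
  "deviation x = x \<otimes> inv (section_of x)"

definition increment :: "'a \<Rightarrow> nat \<Rightarrow> 'a" where
  "increment x i = deviation (section_of x \<otimes> a i)"

lemma deviation_derived: "x \<in> carrier G \<Longrightarrow> deviation x \<in> derived G (carrier G)"
  unfolding deviation_def using section_of[of x] by (intro derived_if_expo_vec_eq) simp_all

lemma derived_closed: "x \<in> derived G (carrier G) \<Longrightarrow> x \<in> carrier G"
  using derived_in_carrier[OF order_refl] by blast

text \<open>Left multiplication by an element of the derived subgroup does not move the vertex and
  so keeps the chosen representative.\<close>

lemma deviation_mult:
  assumes "z \<in> derived G (carrier G)" "x \<in> carrier G"
  shows "deviation (z \<otimes> x) = z \<otimes> deviation x"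
proof -
  have z: "z \<in> carrier G" by (rule derived_closed[OF assms(1)])
  have "expo_vec (z \<otimes> x) = expo_vec x"
    using expo_derived[OF assms(1)] z assms(2) by (auto simp: expo_vec_def)
  then have "section_of (z \<otimes> x) = section_of x" by (rule section_of_cong)
  then show ?thesis unfolding deviation_def using z assms(2) section_of(1)[OF assms(2)] by (simp add: m_assoc)
qed

lemma deviation_step:
  assumes "x \<in> carrier G" "i < r"
  shows "deviation (x \<otimes> a i) = deviation x \<otimes> increment x i"
proof -
  note s = section_of(1)[OF assms(1)] basis_closed[OF assms(2)]
  have "x = deviation x \<otimes> section_of x"
    unfolding deviation_def using assms(1) s by (simp add: m_assoc)
  then have "x \<otimes> a i = deviation x \<otimes> (section_of x \<otimes> a i)"
    using s derived_closed[OF deviation_derived[OF assms(1)]] m_assoc by metis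
  then show ?thesis
    using deviation_mult[OF deviation_derived[OF assms(1)], of "section_of x \<otimes> a i"] s
    by (simp add: increment_def)
qed

lemma increment_cong: "expo_vec x = expo_vec y \<Longrightarrow> increment x i = increment y i"
  using section_of_cong[of x y] by (simp add: increment_def)

lemma increment_derived: "x \<in> carrier G \<Longrightarrow> i < r \<Longrightarrow> increment x i \<in> derived G (carrier G)"
  unfolding increment_def using section_of(1)[of x] basis_closed[of i] by (intro deviation_derived) simp

text \<open>The starting point y allows the path of a product to be read as a path from y followed
  by a path from y times the first factor.\<close>

abbreviation (input) total_increment :: "'a \<Rightarrow> ('a \<times> nat) list \<Rightarrow> 'a" where
  "total_increment y L \<equiv> foldr (\<otimes>) (map (\<lambda>(u, i). increment (y \<otimes> u) i) L) \<one>"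

lemma total_increment_derived:
  assumes "y \<in> carrier G" "set L \<subseteq> carrier G \<times> {..<r}"
  shows "total_increment y L \<in> derived G (carrier G)"
  using assms(2)
proof (induction L)
  case Nil
  show ?case using subgroup.one_closed[OF derived_is_subgroup[OF order_refl]] by simp
next
  case (Cons e L)
  obtain u i where e: "e = (u, i)" by (cases e)
  have "increment (y \<otimes> u) i \<in> derived G (carrier G)"
    using Cons.prems assms(1) e by (intro increment_derived) auto
  then show ?case
    using Cons subgroup.m_closed[OF derived_is_subgroup[OF order_refl]] by (simp add: e)
qed

lemma total_increment_append:
  assumes "y \<in> carrier G" "set L \<subseteq> carrier G \<times> {..<r}" "set L' \<subseteq> carrier G \<times> {..<r}"
  shows "total_increment y (L @ L') = total_increment y L \<otimes> total_increment y L'"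
  using assms(2)
proof (induction L)
  case Nil
  show ?case using total_increment_derived[OF assms(1,3)] derived_closed by simp
next
  case (Cons e L)
  obtain u i where e: "e = (u, i)" by (cases e)
  have "increment (y \<otimes> u) i \<in> carrier G"
    using Cons.prems assms(1) e by (intro derived_closed[OF increment_derived]) auto
  moreover have "total_increment y L \<in> carrier G" "total_increment y L' \<in> carrier G"
    using Cons.prems assms by (auto intro!: derived_closed[OF total_increment_derived])
  ultimately show ?case using Cons by (simp add: e m_assoc)
qed

lemma total_increment_shift:
  assumes "y \<in> carrier G" "x \<in> carrier G" "set L \<subseteq> carrier G \<times> {..<r}"
  shows "total_increment y (map (\<lambda>(u, i). (x \<otimes> u, i)) L) = total_increment (y \<otimes> x) L"
proof -
  have "map (\<lambda>(u, i). increment (y \<otimes> u) i) (map (\<lambda>(u, i). (x \<otimes> u, i)) L)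
      = map (\<lambda>(u, i). increment (y \<otimes> x \<otimes> u) i) L"
    using assms by (auto simp: m_assoc)
  then show ?thesis by (simp only:)
qed

text \<open>Telescoping of \<open>deviation_step\<close> along the word. Backward edges are
  collected on the left-hand side, so no inverses appear, and all factors commute because they lie
  in the derived subgroup. The arbitrary starting point carries the product case.\<close>

lemma deviation_edge_path:
  assumes "edge_path x P N" "y \<in> carrier G"
  shows "deviation (y \<otimes> x) \<otimes> total_increment y N = deviation y \<otimes> total_increment y P"
  using assms
proof (induction arbitrary: y rule: edge_path.induct)
  case edge_path_one
  then show ?case by simp
next
  case (edge_path_basis i)
  have "deviation (y \<otimes> a i) \<in> carrier G" "increment y i \<in> carrier G"
    using edge_path_basis basis_closed
    by (auto intro!: derived_closed[OF deviation_derived] derived_closed[OF increment_derived])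
  then show ?case using deviation_step edge_path_basis by simp
next
  case (edge_path_inv i)
  have 1: "y \<otimes> inv (a i) \<in> carrier G" using edge_path_inv basis_closed by simp
  have "deviation y \<in> carrier G" "increment (y \<otimes> inv (a i)) i \<in> carrier G"
    using edge_path_inv 1
    by (auto intro!: derived_closed[OF deviation_derived] derived_closed[OF increment_derived])
  moreover have "y \<otimes> inv (a i) \<otimes> a i = y"
    using edge_path_inv basis_closed by (simp add: m_assoc)
  ultimately show ?case using deviation_step[OF 1 edge_path_inv(1)] by simp
next
  case (edge_path_mult x z P N P' N')
  note c = edge_path_closed(2)[OF edge_path_mult(3)] edge_path_closed(2)[OF edge_path_mult(4)]
  have yx: "y \<otimes> x \<in> carrier G" using edge_path_mult by simp
  have c': "set (map (\<lambda>(u, i). (x \<otimes> u, i)) P') \<subseteq> carrier G \<times> {..<r}"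
    "set (map (\<lambda>(u, i). (x \<otimes> u, i)) N') \<subseteq> carrier G \<times> {..<r}"
    using c(2) edge_path_mult(1) by auto
  let ?N = "total_increment y N" and ?P = "total_increment y P"
  let ?N' = "total_increment (y \<otimes> x) N'" and ?P' = "total_increment (y \<otimes> x) P'"
  have d: "?N \<in> derived G (carrier G)" "?P \<in> derived G (carrier G)"
    "?N' \<in> derived G (carrier G)" "?P' \<in> derived G (carrier G)"
    "deviation y \<in> derived G (carrier G)" "deviation (y \<otimes> x) \<in> derived G (carrier G)"
    "deviation (y \<otimes> x \<otimes> z) \<in> derived G (carrier G)"
    using c edge_path_mult(2,7) yx by (auto intro!: total_increment_derived deviation_derived)
  note dc = d[THEN derived_closed]
  have "deviation (y \<otimes> (x \<otimes> z)) \<otimes> total_increment y (N @ map (\<lambda>(u, i). (x \<otimes> u, i)) N')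
      = deviation (y \<otimes> x \<otimes> z) \<otimes> (?N \<otimes> ?N')"
    using total_increment_append[OF edge_path_mult(7) _ c'(2)] c(1) edge_path_mult(1,2,7)
      total_increment_shift[OF edge_path_mult(7,1)] c(2) by (simp add: m_assoc)
  also have "\<dots> = (deviation (y \<otimes> x \<otimes> z) \<otimes> ?N') \<otimes> ?N"
    using dc derived_commute[OF d(1,3)] by (simp add: m_assoc)
  also have "\<dots> = (deviation (y \<otimes> x) \<otimes> ?P') \<otimes> ?N"
    using edge_path_mult(6)[OF yx] by simp
  also have "\<dots> = (deviation (y \<otimes> x) \<otimes> ?N) \<otimes> ?P'"
    using dc derived_commute[OF d(1,4)] by (simp add: m_assoc)
  also have "\<dots> = deviation y \<otimes> (?P \<otimes> ?P')"
    using edge_path_mult(5)[OF edge_path_mult(7)] dc by (simp add: m_assoc)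
  also have "\<dots> = deviation y \<otimes> total_increment y (P @ map (\<lambda>(u, i). (x \<otimes> u, i)) P')"
    using total_increment_append[OF edge_path_mult(7) _ c'(1)] c(1)
      total_increment_shift[OF edge_path_mult(7,1)] c(2) by simp
  finally show ?case .
qed

text \<open>With equal flows the two total increments agree: they multiply values that depend only
  on the edge, inside an abelian group. Telescoping from \<open>\<one>\<close> gives
  \<open>deviation x = deviation \<one>\<close>, while \<open>deviation_mult\<close> gives
  \<open>x \<otimes> deviation \<one>\<close> for the same element.\<close>

lemma edge_path_balanced:
  assumes path: "edge_path x P N" and x: "x \<in> derived G (carrier G)"
    and bal: "mset (map (\<lambda>(u, i). (expo_vec u, i)) P) = mset (map (\<lambda>(u, i). (expo_vec u, i)) N)"
  shows "x = \<one>"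
proof -
  let ?D = "G\<lparr>carrier := derived G (carrier G)\<rparr>"
  interpret D: group ?D
    by (rule subgroup_imp_group[OF derived_is_subgroup[OF order_refl]])
  interpret D: comm_group ?D
    by (rule D.group_comm_groupI) (simp add: derived_commute)
  \<comment> \<open>\<open>w\<close> expresses an increment through the edge alone, a vertex and a
    label, so that equality of edge multisets carries over to increments.\<close>
  define w where "w k = increment (SOME u. u \<in> carrier G \<and> expo_vec u = fst k) (snd k)"
    for k :: "(nat \<Rightarrow> int) \<times> nat"
  have w: "w (expo_vec u, i) = increment (\<one> \<otimes> u) i" if "u \<in> carrier G" for u i
  proof -
    let ?v = "SOME v. v \<in> carrier G \<and> expo_vec v = expo_vec u"
    have "expo_vec ?v = expo_vec (\<one> \<otimes> u)"
      using someI[of "\<lambda>v. v \<in> carrier G \<and> expo_vec v = expo_vec u" u] that by simp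
    then have "increment ?v i = increment (\<one> \<otimes> u) i" by (rule increment_cong)
    then show ?thesis by (simp only: w_def fst_conv snd_conv)
  qed
  have c: "set P \<subseteq> carrier G \<times> {..<r}" "set N \<subseteq> carrier G \<times> {..<r}"
    using edge_path_closed(2)[OF path] by auto
  have m: "map (\<lambda>(u, i). increment (\<one> \<otimes> u) i) L = map w (map (\<lambda>(u, i). (expo_vec u, i)) L)"
    if "set L \<subseteq> carrier G \<times> {..<r}" for L
    using that by (auto simp: w)
  have "mset (map (\<lambda>(u, i). increment (\<one> \<otimes> u) i) P) = mset (map (\<lambda>(u, i). increment (\<one> \<otimes> u) i) N)"
    by (simp only: m[OF c(1)] m[OF c(2)] mset_map[of w] bal)
  moreover have "set (map (\<lambda>(u, i). increment (\<one> \<otimes> u) i) P) \<subseteq> carrier ?D"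
  proof
    fix z assume "z \<in> set (map (\<lambda>(u, i). increment (\<one> \<otimes> u) i) P)"
    then obtain u i where z: "(u, i) \<in> set P" "z = increment (\<one> \<otimes> u) i" by auto
    then have "u \<in> carrier G" "i < r" using c(1) by auto
    then show "z \<in> carrier ?D" unfolding z(2) by (simp add: increment_derived)
  qed
  ultimately have eq: "total_increment \<one> P = total_increment \<one> N"
    using D.multlist_perm_cong[of "map (\<lambda>(u, i). increment (\<one> \<otimes> u) i) P"] by simp
  have dc: "total_increment \<one> N \<in> carrier G" "deviation \<one> \<in> carrier G" "x \<in> carrier G"
    using derived_closed[OF total_increment_derived[OF one_closed c(2)]]
      derived_closed[OF deviation_derived[OF one_closed]] derived_closed[OF x] by blast+
  have "deviation x = x \<otimes> deviation \<one>"
    using deviation_mult[OF x, of \<one>] dc by simp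
  then have "x \<otimes> (deviation \<one> \<otimes> total_increment \<one> N) = \<one> \<otimes> (deviation \<one> \<otimes> total_increment \<one> N)"
    using deviation_edge_path[OF path one_closed] eq dc by (simp add: m_assoc)
  then show ?thesis using dc by (simp only: r_cancel m_closed one_closed)
qed

text \<open>The Magnus embedding with its variables specialized to powers of q: each edge
  contributes \<open>b i\<close> scaled by the multiplier at its source. The inverse of an affine
  map fits this rule because a backward step ends at the source of its edge.\<close>

lemma bs_group_edge_path:
  fixes W :: "nat \<Rightarrow> int" and b :: "nat \<Rightarrow> rat"
  assumes "edge_path x P N" and q: "q \<noteq> 0" and \<rho>: "\<rho> \<in> hom G (bs_group q)"
    and \<rho>a: "\<And>i. i < r \<Longrightarrow> \<rho> (a i) = (W i, b i)"
  shows "\<rho> x = (\<Sum>j<r. W j * expo_vec x j,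
    (\<Sum>(u, i)\<leftarrow>P. q powi (\<Sum>j<r. W j * expo_vec u j) * b i) -
    (\<Sum>(u, i)\<leftarrow>N. q powi (\<Sum>j<r. W j * expo_vec u j) * b i))"
  using assms(1)
proof (induction rule: edge_path.induct)
  interpret B: group "bs_group q" by (rule group_bs_group[OF q])
  interpret \<rho>: group_hom G "bs_group q" \<rho> using \<rho> by unfold_locales
  have W: "(\<Sum>j<r. W j * expo_vec (a i) j) = W i" if "i < r" for i
  proof -
    have "(\<Sum>j<r. W j * expo_vec (a i) j) = (\<Sum>j<r. if j = i then W j else 0)"
      using that by (intro sum.cong) (auto simp: expo_vec_def expo_basis)
    then show ?thesis using that by simp
  qed
  have Wm: "(\<Sum>j<r. W j * expo_vec (u \<otimes> v) j) = (\<Sum>j<r. W j * expo_vec u j) + (\<Sum>j<r. W j * expo_vec v j)"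
    if "u \<in> carrier G" "v \<in> carrier G" for u v
    unfolding sum.distrib[symmetric] using that by (intro sum.cong) (auto simp: expo_vec_def algebra_simps)
  have W1: "(\<Sum>j<r. W j * expo_vec \<one> j) = 0"
    by (simp add: expo_vec_def)
  have Wi: "(\<Sum>j<r. W j * expo_vec (inv (a i)) j) = - W i" if "i < r" for i
    using Wm[of "a i" "inv (a i)"] basis_closed[OF that] W[OF that] W1 by simp
  {
    case edge_path_one
    then show ?case using W1 by simp
  next
    case (edge_path_basis i)
    then show ?case using W W1 \<rho>a by simp
  next
    case (edge_path_inv i)
    then show ?case using Wi \<rho>a basis_closed q by (simp add: inv_bs_group)
  next
    case (edge_path_mult x y P N P' N')
    have shift: "(\<Sum>(u, i)\<leftarrow>map (\<lambda>(u, i). (x \<otimes> u, i)) L. q powi (\<Sum>j<r. W j * expo_vec u j) * b i)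
        = q powi (\<Sum>j<r. W j * expo_vec x j) * (\<Sum>(u, i)\<leftarrow>L. q powi (\<Sum>j<r. W j * expo_vec u j) * b i)"
      if "set L \<subseteq> carrier G \<times> {..<r}" for L
      using that
    proof (induction L)
      case (Cons e L)
      then show ?case
        using Wm edge_path_mult(1) q by (cases e) (simp add: power_int_add algebra_simps)
    qed simp
    note c = edge_path_closed(2)[OF edge_path_mult(4)]
    show ?case
      using edge_path_mult Wm shift[of P'] shift[of N'] c by (simp add: algebra_simps)
  }
qed

text \<open>Commutators are translations with coefficients in Z[1/q], which places the derived
  subgroup at level 0. A further commutator of (0, b) with (l, c) is (0, (1 - q^l) b) and gains a
  factor 2 because q is odd.\<close>

lemma bs_group_lower_central:
  assumes q: "odd q" and \<rho>: "\<rho> \<in> hom G (bs_group (of_int q))"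
    and \<rho>a: "\<And>i. i < r \<Longrightarrow> \<exists>m z. \<rho> (a i) = (m, of_int z)"
    and x: "x \<in> lower_central G (Suc n)"
  shows "fst (\<rho> x) = 0 \<and> snd (\<rho> x) \<in> dyadic_ideal q n"
proof -
  have q0: "q \<noteq> 0" and q1: "(of_int q :: rat) \<noteq> 0" using q by auto
  interpret B: group "bs_group (of_int q)" by (rule group_bs_group[OF q1])
  interpret \<rho>: group_hom G "bs_group (of_int q)" \<rho> using \<rho> by unfold_locales
  have int: "snd (\<rho> y) \<in> dyadic_ideal q 0" if "y \<in> carrier G" for y
    using that
  proof (induction rule: basis_induct)
    case one
    show ?case by (simp add: zero_dyadic_ideal)
  next
    case (basis i)
    then show ?case using \<rho>a[of i] of_int_dyadic_ideal by auto
  next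
    case (inv_basis i)
    obtain m z where "\<rho> (a i) = (m, of_int z)" using \<rho>a[OF inv_basis] by blast
    then show ?case
      using basis_closed[OF inv_basis] powi_mult_dyadic_ideal[OF of_int_dyadic_ideal q0]
      by (simp add: inv_bs_group[OF q1] minus_dyadic_ideal)
  next
    case (mult y z)
    then show ?case
      by (cases "\<rho> y"; cases "\<rho> z") (simp add: add_dyadic_ideal powi_mult_dyadic_ideal q0)
  qed
  have sub: "subgroup {y \<in> carrier G. fst (\<rho> y) = 0 \<and> snd (\<rho> y) \<in> dyadic_ideal q n} G" for n
  proof (rule subgroupI)
    let ?S = "{y \<in> carrier G. fst (\<rho> y) = 0 \<and> snd (\<rho> y) \<in> dyadic_ideal q n}"
    have "\<one> \<in> ?S" by (simp add: zero_dyadic_ideal)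
    then show "?S \<noteq> {}" by blast
    fix y assume y: "y \<in> ?S"
    then show "inv y \<in> ?S"
      by (cases "\<rho> y") (simp add: inv_bs_group[OF q1] minus_dyadic_ideal)
    fix z assume "z \<in> ?S"
    with y show "y \<otimes> z \<in> ?S"
      by (cases "\<rho> y"; cases "\<rho> z") (simp add: add_dyadic_ideal)
  qed auto
  have com: "\<rho> (commutator G y z) = commutator (bs_group (of_int q)) (\<rho> y) (\<rho> z)"
    if "y \<in> carrier G" "z \<in> carrier G" for y z
    using that by simp
  have "lower_central G (Suc n) \<subseteq> {y \<in> carrier G. fst (\<rho> y) = 0 \<and> snd (\<rho> y) \<in> dyadic_ideal q n}"
  proof (induction n)
    case 0
    show ?case unfolding lower_central.simps
    proof (rule generate_subgroup_incl[OF _ sub], safe)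
      fix y z assume yz: "y \<in> carrier G" "z \<in> carrier G"
      obtain m b where y: "\<rho> y = (m, b)" by (cases "\<rho> y")
      obtain n c where z: "\<rho> z = (n, c)" by (cases "\<rho> z")
      have bc: "b \<in> dyadic_ideal q 0" "c \<in> dyadic_ideal q 0" using int[OF yz(1)] int[OF yz(2)] y z by auto
      have "\<rho> (commutator G y z) = (0, b + - (of_int q powi n * b) + (of_int q powi m * c + - c))"
        unfolding com[OF yz] y z commutator_bs_group[OF q1] by (simp add: algebra_simps)
      moreover have "b + - (of_int q powi n * b) + (of_int q powi m * c + - c) \<in> dyadic_ideal q 0"
        using bc q0 by (intro add_dyadic_ideal minus_dyadic_ideal powi_mult_dyadic_ideal)
      ultimately show "fst (\<rho> (commutator G y z)) = 0" "snd (\<rho> (commutator G y z)) \<in> dyadic_ideal q 0"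
        by (simp_all only: fst_conv snd_conv)
      show "commutator G y z \<in> carrier G" using yz by simp
    qed
  next
    case (Suc n)
    show ?case unfolding lower_central.simps(2)[of G "Suc n"]
    proof (rule generate_subgroup_incl[OF _ sub], safe)
      fix y z assume y': "y \<in> lower_central G (Suc n)" and z': "z \<in> carrier G"
      have yc: "y \<in> carrier G" using y' lower_central_subset by blast
      obtain b where y: "\<rho> y = (0, b)" and b: "b \<in> dyadic_ideal q n"
        using y' Suc by (cases "\<rho> y") auto
      obtain l c where z: "\<rho> z = (l, c)" by (cases "\<rho> z")
      have "\<rho> (commutator G y z) = (0, (1 - of_int q powi l) * b)"
        unfolding com[OF yc z'] y z commutator_bs_group[OF q1] by simp
      then show "fst (\<rho> (commutator G y z)) = 0" "snd (\<rho> (commutator G y z)) \<in> dyadic_ideal q (Suc n)"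
        using one_minus_powi_mult_dyadic_ideal[OF b q] by (simp_all only: fst_conv snd_conv)
      show "commutator G y z \<in> carrier G" using yc z' by simp
    qed
  qed
  then show ?thesis using x by blast
qed

lemma residually_nilpotent_if_bs_group_homs:
  assumes homs: "\<And>(q::rat) (W :: nat \<Rightarrow> int) (b :: nat \<Rightarrow> rat). q \<noteq> 0 \<Longrightarrow>
      \<exists>\<rho>\<in>hom G (bs_group q). \<forall>i<r. \<rho> (a i) = (W i, b i)"
    and x: "\<And>n. x \<in> lower_central G n"
  shows "x = \<one>"
proof -
  have xc: "x \<in> carrier G" using x[of 0] by simp
  have xd: "x \<in> derived G (carrier G)" using x[of 1] lower_central_1[of G] by simp
  obtain P N where path: "edge_path x P N" using edge_path_exists[OF xc] by blast
  let ?P = "map (\<lambda>(u, i). (expo_vec u, i)) P" and ?N = "map (\<lambda>(u, i). (expo_vec u, i)) N"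
  have "mset ?P = mset ?N"
  proof (rule ccontr)
    assume ne: "mset ?P \<noteq> mset ?N"
    obtain W q i0 where q: "odd q"
      and W: "(\<Sum>(\<alpha>, i)\<leftarrow>?P. of_int q powi (\<Sum>j<r. W j * \<alpha> j) * (if i = i0 then 1 else 0)) \<noteq>
        (\<Sum>(\<alpha>, i)\<leftarrow>?N. (of_int q :: rat) powi (\<Sum>j<r. W j * \<alpha> j) * (if i = i0 then 1 else 0))"
      using separating_evaluation[OF ne, of r] by (fastforce simp: expo_vec_def)
    have q1: "(of_int q :: rat) \<noteq> 0" using q by auto
    \<comment> \<open>With translation parts concentrated on the label i0, the second coordinate of
      \<open>\<rho> x\<close> is the difference of the two separated sums.\<close>
    obtain \<rho> where \<rho>: "\<rho> \<in> hom G (bs_group (of_int q))"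
      "\<And>i. i < r \<Longrightarrow> \<rho> (a i) = (W i, if i = i0 then 1 else 0)"
      using homs[OF q1, of W "\<lambda>i. if i = i0 then 1 else 0"] by blast
    have \<rho>': "\<exists>m z. \<rho> (a i) = (m, of_int z)" if "i < r" for i
      using \<rho>(2)[OF that] by (intro exI[of _ "W i"] exI[of _ "if i = i0 then 1 else 0"]) simp
    have "snd (\<rho> x) \<in> dyadic_ideal q n" for n
      using bs_group_lower_central[OF q \<rho>(1) \<rho>' x] by blast
    then have "snd (\<rho> x) = 0" by (rule Inter_dyadic_ideal[OF q])
    moreover have "snd (\<rho> x) =
      (\<Sum>(u, i)\<leftarrow>P. of_int q powi (\<Sum>j<r. W j * expo_vec u j) * (if i = i0 then 1 else 0)) -
      (\<Sum>(u, i)\<leftarrow>N. of_int q powi (\<Sum>j<r. W j * expo_vec u j) * (if i = i0 then 1 else 0))"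
      by (subst bs_group_edge_path[OF path q1 \<rho>]) auto
    ultimately show False
      using W by (simp add: case_prod_unfold o_def)
  qed
  then show ?thesis by (rule edge_path_balanced[OF path xd])
qed

end

section \<open>Relatively free groups\<close>

lemma (in group) metabelianI:
  assumes S: "subgroup S G" and com: "\<And>x y. x \<in> carrier G \<Longrightarrow> y \<in> carrier G \<Longrightarrow> commutator G x y \<in> S"
    and abel: "\<And>x y. x \<in> S \<Longrightarrow> y \<in> S \<Longrightarrow> x \<otimes> y = y \<otimes> x"
  shows "derived G (derived G (carrier G)) = {\<one>}"
proof -
  have D: "derived G (carrier G) \<subseteq> S"
    unfolding derived_def using com by (intro generate_subgroup_incl[OF _ S]) auto
  have "derived_set G (derived G (carrier G)) \<subseteq> {\<one>}"
  proof safe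
    fix x y assume "x \<in> derived G (carrier G)" "y \<in> derived G (carrier G)"
    then have "x \<in> S" "y \<in> S" using D by auto
    then show "commutator G x y = \<one>"
      using abel[of x y] commutator_eq_one_iff[of x y] subgroup.mem_carrier[OF S] by simp
  qed
  then have "derived G (derived G (carrier G)) \<subseteq> {\<one>}"
    unfolding derived_def[of G "derived G (carrier G)"]
    by (intro generate_subgroup_incl[OF _ triv_subgroup])
  then show ?thesis
    using subgroup.one_closed[OF derived_is_subgroup[OF derived_in_carrier[OF order_refl]]] by blast
qed

section \<open>Test groups and closure properties of the varieties\<close>

lemma metabelian_heisenberg: "metabelian heisenberg"
proof -
  interpret group heisenberg by (rule group_heisenberg)
  have "subgroup {x. fst x = 0 \<and> fst (snd x) = 0} heisenberg"
    by (rule subgroupI) auto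
  then have "derived heisenberg (derived heisenberg (carrier heisenberg)) = {\<one>\<^bsub>heisenberg\<^esub>}"
    by (rule metabelianI) auto
  then show ?thesis unfolding metabelian_def using group_heisenberg by blast
qed

lemma lower_central_heisenberg: "lower_central heisenberg (Suc (Suc n)) = {\<one>\<^bsub>heisenberg\<^esub>}"
proof -
  interpret plain_group heisenberg unfolding plain_group_def by (rule group_heisenberg)
  have S: "subgroup {x. fst x = 0 \<and> fst (snd x) = 0} heisenberg"
    by (rule subgroupI) auto
  have 1: "lower_central heisenberg (Suc 0) \<subseteq> {x. fst x = 0 \<and> fst (snd x) = 0}"
    unfolding lower_central.simps by (intro generate_subgroup_incl[OF _ S]) auto
  have "lower_central heisenberg (Suc (Suc 0)) \<subseteq> {\<one>\<^bsub>heisenberg\<^esub>}"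
    unfolding lower_central.simps(2)[of _ "Suc 0"]
    using 1 by (intro generate_subgroup_incl[OF _ triv_subgroup]) auto
  then have "lower_central heisenberg (Suc (Suc n)) \<subseteq> {\<one>\<^bsub>heisenberg\<^esub>}"
  proof (induction n)
    case (Suc n)
    then show ?case using lower_central_decreasing[of "Suc (Suc n)"] by blast
  qed
  then show ?thesis
    using subgroup.one_closed[OF normal_imp_subgroup[OF lower_central_normal]] by blast
qed

lemma metabelian_bs_group:
  assumes "q \<noteq> 0"
  shows "metabelian (bs_group q)"
proof -
  interpret group "bs_group q" by (rule group_bs_group[OF assms])
  have "subgroup {x. fst x = 0} (bs_group q)"
    by (rule subgroupI) (auto simp: inv_bs_group[OF assms])
  then have "derived (bs_group q) (derived (bs_group q) (carrier (bs_group q))) = {\<one>\<^bsub>bs_group q\<^esub>}"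
    by (rule metabelianI) (auto simp: inv_bs_group[OF assms])
  then show ?thesis unfolding metabelian_def using group_bs_group[OF assms] by blast
qed

lemma metabelian_img:
  assumes "group_hom K L e" "e ` carrier K = carrier L" "metabelian K"
  shows "metabelian L"
proof -
  interpret group_hom K L e by fact
  have "derived L (derived L (e ` carrier K)) = e ` {\<one>\<^bsub>K\<^esub>}"
    using assms(3) derived_img[OF order_refl] derived_img[OF G.derived_in_carrier[OF order_refl]]
    by (simp add: metabelian_def)
  then show ?thesis unfolding metabelian_def using assms(2) H.is_group by simp
qed

lemma nilpotent_class_le_img:
  assumes "group_hom K L e" "e ` carrier K = carrier L" "nilpotent_class_le K k"
  shows "nilpotent_class_le L k"
proof -
  interpret group_hom K L e by fact
  show ?thesis
    using lower_central_img[OF assms(1,2), of k] assms(3) H.is_group by (simp add: nilpotent_class_le_def)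
qed

lemma metabelian_subgroup:
  fixes G (structure)
  assumes "metabelian G" "subgroup H G"
  shows "metabelian (G\<lparr>carrier := H\<rparr>)"
proof -
  interpret group G using assms(1) by (simp add: metabelian_def)
  interpret K: group "G\<lparr>carrier := H\<rparr>" by (rule subgroup_imp_group[OF assms(2)])
  have HG: "H \<subseteq> carrier G" by (rule subgroup.subset[OF assms(2)])
  have 1: "derived (G\<lparr>carrier := H\<rparr>) H = derived G H"
    by (rule derived_consistent[OF order_refl assms(2)])
  have 2: "derived (G\<lparr>carrier := H\<rparr>) (derived G H) = derived G (derived G H)"
    by (rule derived_consistent[OF derived_incl[OF order_refl assms(2)] assms(2)])
  have "derived G (derived G H) \<subseteq> derived G (derived G (carrier G))"
    by (intro mono_derived HG)
  then have "derived G (derived G H) = {\<one>}"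
    using assms(1) subgroup.one_closed[OF derived_is_subgroup[OF derived_in_carrier[OF HG]]]
    by (auto simp: metabelian_def)
  then show ?thesis unfolding metabelian_def using K.is_group 1 2 by simp
qed

lemma nilpotent_class_le_subgroup:
  fixes G (structure)
  assumes "nilpotent_class_le G k" "subgroup H G"
  shows "nilpotent_class_le (G\<lparr>carrier := H\<rparr>) k"
proof -
  interpret plain_group G using assms(1) by (simp add: nilpotent_class_le_def plain_group_def)
  interpret K: plain_group "G\<lparr>carrier := H\<rparr>"
    unfolding plain_group_def by (rule subgroup_imp_group[OF assms(2)])
  have "lower_central (G\<lparr>carrier := H\<rparr>) k \<subseteq> {\<one>}"
    using lower_central_of_subgroup[OF assms(2), of k] assms(1) by (simp add: nilpotent_class_le_def)
  then have "lower_central (G\<lparr>carrier := H\<rparr>) k = {\<one>}"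
    using subgroup.one_closed[OF normal_imp_subgroup[OF K.lower_central_normal], of k] by auto
  then show ?thesis unfolding nilpotent_class_le_def using K.is_group by simp
qed

text \<open>The extension property in \<open>relatively_free\<close> concerns only groups over the
  type of \<open>G\<close>. An injection of a countable type into that infinite type transports a
  group there, which makes the concrete test groups available as targets.\<close>

lemma countable_group_copy:
  fixes K :: "'k::countable monoid"
  assumes "infinite (UNIV :: 'g set)" "group K"
  shows "\<exists>(L :: 'g monoid) e. group L \<and> e \<in> iso K L"
proof -
  obtain s :: "nat \<Rightarrow> 'g" where "inj s"
    using assms(1) infinite_countable_subset by blast
  then have e: "inj (\<lambda>x. s (to_nat (x :: 'k)))"
    by (auto intro!: injI dest: injD)
  let ?e = "\<lambda>x. s (to_nat (x :: 'k))"
  interpret K: group K by fact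
  have "weak_group_morphism ?e {\<one>\<^bsub>K\<^esub>} K"
  proof (rule weak_group_morphismsI)
    show "{\<one>\<^bsub>K\<^esub>} \<lhd> K" by (rule K.one_is_normal)
    fix x y assume "x \<in> carrier K" "y \<in> carrier K"
    then show "?e x = ?e y \<longleftrightarrow> x \<otimes>\<^bsub>K\<^esub> inv\<^bsub>K\<^esub> y \<in> {\<one>\<^bsub>K\<^esub>}"
      using inj_eq[OF e, of x y] K.inv_equality[of x "inv\<^bsub>K\<^esub> y"] by auto
  qed
  then have "group (image_group ?e K)" "?e \<in> hom K (image_group ?e K)"
    using K.image_group_is_group K.weak_group_morphism_is_hom by blast+
  moreover have "bij_betw ?e (carrier K) (carrier (image_group ?e K))"
    unfolding image_group_carrier using inj_on_subset[OF e] by (simp add: bij_betw_def)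
  ultimately show ?thesis by (auto simp: iso_def)
qed

text \<open>\<open>V\<close> speaks of groups over the type of \<open>G\<close> and cannot be
  applied to \<open>K\<close> itself. Asking for it on all homomorphic images of \<open>K\<close>
  over that type covers the copy, of which only the existence is known.\<close>

lemma relatively_free_hom_countable:
  fixes K :: "'k::countable monoid" and G :: "'g monoid"
  assumes inf: "infinite (UNIV :: 'g set)" and free: "relatively_free V G a r" and K: "group K"
    and V: "\<And>(L :: 'g monoid) e. group_hom K L e \<Longrightarrow> e ` carrier K = carrier L \<Longrightarrow> V L"
    and b: "\<And>i. i < r \<Longrightarrow> b i \<in> carrier K"
  shows "\<exists>h\<in>hom G K. \<forall>i<r. h (a i) = b i"
proof -
  obtain L :: "'g monoid" and e where L: "group L" and e: "e \<in> iso K L"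
    using countable_group_copy[OF inf K] by blast
  interpret e: group_hom K L e
    using K L e by (auto simp: group_hom_def group_hom_axioms_def iso_def)
  have onto: "e ` carrier K = carrier L" and inj: "inj_on e (carrier K)"
    using e by (auto simp: iso_def bij_betw_def)
  have "V L" by (rule V[OF e.group_hom_axioms onto])
  moreover have "(\<lambda>i. e (b i)) ` {..<r} \<subseteq> carrier L" using b by auto
  ultimately obtain h where h: "h \<in> hom G L" "\<forall>i<r. h (a i) = e (b i)"
    using free L unfolding relatively_free_def by meson
  have "inv_into (carrier K) e \<in> hom L K"
    using group.iso_set_sym[OF K e] by (simp add: iso_def)
  from Group.hom_compose[OF h(1) this] have "inv_into (carrier K) e \<circ> h \<in> hom G K" .
  then show ?thesis
    using h(2) inj b by (intro bexI[of _ "inv_into (carrier K) e \<circ> h"]) auto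
qed

lemma relatively_free_based_metabelian_group:
  fixes G :: "'g monoid" (structure)
  assumes inf: "infinite (UNIV :: 'g set)" and free: "relatively_free V G a r"
    and metab: "metabelian G" and sub: "\<And>H. subgroup H G \<Longrightarrow> V (G\<lparr>carrier := H\<rparr>)"
    and heis: "\<And>(L :: 'g monoid) e. group_hom heisenberg L e \<Longrightarrow> e ` carrier heisenberg = carrier L \<Longrightarrow> V L"
  shows "based_metabelian_group G a r"
proof -
  interpret group G using metab by (simp add: metabelian_def)
  show ?thesis
  proof (unfold_locales)
    show "x \<otimes> y = y \<otimes> x"
      if xy: "x \<in> derived G (carrier G)" "y \<in> derived G (carrier G)" for x y
    proof -
      have c: "x \<in> carrier G" "y \<in> carrier G" using xy derived_in_carrier[OF order_refl] by blast+
      have "commutator G x y \<in> derived G (derived G (carrier G))"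
        unfolding derived_def[of G "derived G (carrier G)"] using xy by (intro generate.incl) blast
      then show ?thesis
        using metab commutator_eq_one_iff[OF c] by (simp add: metabelian_def)
    qed
    show "a i \<in> carrier G" if "i < r" for i
      using free that unfolding relatively_free_def by blast
    show "generate G (a ` {..<r}) = carrier G"
      using free unfolding relatively_free_def by blast
    show "\<exists>\<phi>\<in>hom G (G\<lparr>carrier := H\<rparr>). \<forall>i<r. \<phi> (a i) = b i"
      if H: "subgroup H G" and b: "\<And>i. i < r \<Longrightarrow> b i \<in> H" for H b
    proof -
      have "group (G\<lparr>carrier := H\<rparr>)" "b ` {..<r} \<subseteq> carrier (G\<lparr>carrier := H\<rparr>)"
        using subgroup_imp_group[OF H] b by auto
      then show ?thesis using free sub[OF H] unfolding relatively_free_def by blast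
    qed
    show "\<exists>h\<in>hom G heisenberg. \<forall>i<r. h (a i) = (\<alpha> i, \<beta> i, 0)" for \<alpha> \<beta> :: "nat \<Rightarrow> int"
      by (rule relatively_free_hom_countable[OF inf free group_heisenberg heis]) simp_all
  qed
qed

lemma free_metabelian_residually_nilpotent_based_group:
  fixes G :: "'g monoid"
  assumes inf: "infinite (UNIV :: 'g set)" and free: "relatively_free metabelian G a r"
  shows "residually_nilpotent_based_group G a r"
proof -
  have metab: "metabelian G" using free by (simp add: relatively_free_def)
  interpret based_metabelian_group G a r
    using metabelian_subgroup[OF metab] metabelian_img[OF _ _ metabelian_heisenberg]
    by (intro relatively_free_based_metabelian_group[OF inf free metab]) auto
  have "\<exists>\<rho>\<in>hom G (bs_group q). \<forall>i<r. \<rho> (a i) = (W i, b i)"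
    if "q \<noteq> 0" for q and W :: "nat \<Rightarrow> int" and b :: "nat \<Rightarrow> rat"
    using metabelian_img[OF _ _ metabelian_bs_group[OF that]]
    by (intro relatively_free_hom_countable[OF inf free group_bs_group[OF that]]) auto
  then show ?thesis
    using residually_nilpotent_if_bs_group_homs by unfold_locales blast
qed

text \<open>k >= 2 puts the Heisenberg group, of class 2, into the variety. Residual nilpotence is
  immediate, since \<open>lower_central G k\<close> is already trivial.\<close>

lemma free_nilpotent_residually_nilpotent_based_group:
  fixes G :: "'g monoid"
  assumes inf: "infinite (UNIV :: 'g set)" and k: "k \<ge> 2"
    and free: "relatively_free (metabelian_nilpotent k) G a r"
  shows "residually_nilpotent_based_group G a r"
proof -
  have metab: "metabelian G" and nil: "nilpotent_class_le G k"
    using free by (simp_all add: relatively_free_def metabelian_nilpotent_def)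
  obtain n where n: "k = Suc (Suc n)" using k by (metis add_2_eq_Suc le_Suc_ex)
  have heis: "nilpotent_class_le heisenberg k"
    unfolding nilpotent_class_le_def n using lower_central_heisenberg group_heisenberg by blast
  interpret based_metabelian_group G a r
    using metabelian_subgroup[OF metab] nilpotent_class_le_subgroup[OF nil]
      metabelian_img[OF _ _ metabelian_heisenberg] nilpotent_class_le_img[OF _ _ heis]
    by (intro relatively_free_based_metabelian_group[OF inf free metab])
      (auto simp: metabelian_nilpotent_def)
  show ?thesis
  proof
    show "x = \<one>\<^bsub>G\<^esub>" if "\<And>n. x \<in> lower_central G n" for x
      using that[of k] nil by (simp add: nilpotent_class_le_def)
  qed
qed

section \<open>The equivalence\<close>

lemma (in plain_group) geval_hom:
  assumes "\<phi> \<in> hom G G" "range \<sigma> \<subseteq> carrier G" "gconsts w \<subseteq> carrier G" "\<And>c. c \<in> gconsts w \<Longrightarrow> \<phi> c = c"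
  shows "geval G \<sigma> w \<in> carrier G \<and> geval G (\<lambda>i. \<phi> (\<sigma> i)) w = \<phi> (geval G \<sigma> w)"
proof -
  interpret group_hom G G \<phi> using assms(1) by unfold_locales
  show ?thesis using assms(2-4) by (induction w) auto
qed

text \<open>The retraction commutes with evaluation and fixes the constants, so it carries a
  solution in \<open>G\<close> to one in \<open>H\<close>.\<close>

lemma (in plain_group) retract_imp_algebraically_closed:
  assumes "retract H G"
  shows "algebraically_closed H G"
  unfolding algebraically_closed_def
proof (intro allI impI)
  fix E :: "'a gword list"
  assume E: "\<forall>e\<in>set E. gconsts e \<subseteq> H"
    and "\<exists>\<sigma>. range \<sigma> \<subseteq> carrier G \<and> (\<forall>e\<in>set E. geval G \<sigma> e = \<one>)"
  then obtain \<sigma> where \<sigma>: "range \<sigma> \<subseteq> carrier G" "\<forall>e\<in>set E. geval G \<sigma> e = \<one>" by blast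
  obtain \<phi> where H: "subgroup H G" and \<phi>: "\<phi> \<in> hom G (G\<lparr>carrier := H\<rparr>)" "\<forall>x\<in>H. \<phi> x = x"
    using assms unfolding retract_def by blast
  have HG: "H \<subseteq> carrier G" by (rule subgroup.subset[OF H])
  have \<phi>H: "\<phi> x \<in> H" if "x \<in> carrier G" for x using hom_in_carrier[OF \<phi>(1) that] by simp
  have \<phi>G: "\<phi> \<in> hom G G" using \<phi>(1) \<phi>H HG by (auto simp: hom_def)
  have "geval G (\<lambda>i. \<phi> (\<sigma> i)) e = \<one>" if e: "e \<in> set E" for e
  proof -
    have "gconsts e \<subseteq> H" using E e by blast
    then have "geval G (\<lambda>i. \<phi> (\<sigma> i)) e = \<phi> (geval G \<sigma> e)"
      using geval_hom[OF \<phi>G \<sigma>(1), of e] HG \<phi>(2) by blast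
    then show ?thesis using \<sigma>(2) e hom_one[OF \<phi>G is_group is_group] by simp
  qed
  moreover have "range (\<lambda>i. \<phi> (\<sigma> i)) \<subseteq> H" using \<sigma>(1) \<phi>H by auto
  ultimately show "\<exists>\<sigma>. range \<sigma> \<subseteq> H \<and> (\<forall>e\<in>set E. geval G \<sigma> e = \<one>)" by blast
qed

text \<open>The equation w = h is the one-equation system w h^-1 = 1 with the constant h from
  \<open>H\<close>.\<close>

lemma (in plain_group) algebraically_closed_imp_verbally_closed:
  assumes H: "subgroup H G" and ac: "algebraically_closed H G"
  shows "verbally_closed H G"
  unfolding verbally_closed_def
proof (intro allI ballI impI iffI)
  fix w :: "'a gword" and h assume h: "h \<in> H" and w: "gconsts w = {}"
  have HG: "H \<subseteq> carrier G" by (rule subgroup.subset[OF H])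
  have eq: "geval G \<sigma> (GMul w (GInv (GConst h))) = \<one> \<longleftrightarrow> geval G \<sigma> w = h"
    if "range \<sigma> \<subseteq> carrier G" for \<sigma>
  proof -
    have id: "(\<lambda>x. x) \<in> hom G G" by (auto simp: hom_def)
    have "geval G \<sigma> w \<in> carrier G" using geval_hom[OF id that, of w] w by simp
    then show ?thesis
      using h HG inv_equality[of "geval G \<sigma> w" "inv h"] by auto
  qed
  {
    assume "\<exists>\<sigma>. range \<sigma> \<subseteq> carrier G \<and> geval G \<sigma> w = h"
    then have "\<exists>\<sigma>. range \<sigma> \<subseteq> carrier G \<and> (\<forall>e\<in>set [GMul w (GInv (GConst h))]. geval G \<sigma> e = \<one>)"
      using eq by auto
    moreover have "\<forall>e\<in>set [GMul w (GInv (GConst h))]. gconsts e \<subseteq> H" using h w by simp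
    ultimately obtain \<sigma> where "range \<sigma> \<subseteq> H" "geval G \<sigma> (GMul w (GInv (GConst h))) = \<one>"
      using ac unfolding algebraically_closed_def by (metis list.set_intros(1))
    then show "\<exists>\<sigma>. range \<sigma> \<subseteq> H \<and> geval G \<sigma> w = h" using eq HG by blast
  next
    assume "\<exists>\<sigma>. range \<sigma> \<subseteq> H \<and> geval G \<sigma> w = h"
    then show "\<exists>\<sigma>. range \<sigma> \<subseteq> carrier G \<and> geval G \<sigma> w = h" using HG by blast
  }
qed

theorem theorem4p1:
  fixes G :: "'g monoid" and a :: "nat \<Rightarrow> 'g" and r k :: nat and g f :: 'g
  assumes "infinite (UNIV :: 'g set)"
    and "r \<ge> 2" and "k \<ge> 4"
    and "relatively_free metabelian G a r \<or> relatively_free (metabelian_nilpotent k) G a r"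
    and "g \<in> carrier G" and "f \<in> carrier G"
  shows "(retract (generate G {g, f}) G \<longleftrightarrow> algebraically_closed (generate G {g, f}) G)
       \<and> (algebraically_closed (generate G {g, f}) G \<longleftrightarrow> verbally_closed (generate G {g, f}) G)"
proof -
  have "residually_nilpotent_based_group G a r"
    using assms(4)
  proof
    assume "relatively_free metabelian G a r"
    then show ?thesis by (rule free_metabelian_residually_nilpotent_based_group[OF assms(1)])
  next
    assume "relatively_free (metabelian_nilpotent k) G a r"
    then show ?thesis
      using assms(3) by (intro free_nilpotent_residually_nilpotent_based_group[OF assms(1)]) auto
  qed
  then interpret residually_nilpotent_based_group G a r .
  have "subgroup (generate G {g, f}) G"
    using assms(5,6) by (intro generate_is_subgroup) auto
  then show ?thesis
    using retract_imp_algebraically_closed algebraically_closed_imp_verbally_closed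
      verbally_closed_imp_retract[OF assms(5,6)] by blast
qed

end
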